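(* Let $\mathbb{D}$ be the open unit disk and $\mathbb{T}$ the unit circle in $\mathbb{C}$. Suppose $\Gamma\subset\mathbb{T}$ is both an $F_\sigma$ set (countable union of closed sets) and a $G_\delta$ set (countable intersection of open sets). Then there exists a Hilbert space $\mathcal{H}\subset\operatorname{Hol}(\mathbb{D})$ satisfying properties P1, P2, P3 on $\mathbb{D}$ (see context) such that $\Omega_{max}=\mathbb{D}\cup\Gamma$.
   Context: $\operatorname{Hol}(\mathbb{D})$ is the space of holomorphic functions on $\mathbb{D}$. $\mathcal{P}_1$ is the set of polynomials in one complex variable, viewed as functions on $\mathbb{D}$. For a Hilbert space $\mathcal{H}\subset\operatorname{Hol}(\mathbb{D})$ (a complex vector space of holomorphic functions with a complete inner product), the properties are: P1: $\mathcal{P}_1\subset\mathcal{H}$ and $\mathcal{P}_1$ is dense in $\mathcal{H}$. P2: for each $w\in\mathbb{D}$ the evaluation functional $\Lambda_w(F)=F(w)$, $F\in\mathcal{H}$, is continuous. P3: the shift operator $SF(z)=zF(z)$ maps $\mathcal{H}$ to $\mathcal{H}$ and is continuous. Maximal domain of $\mathcal{H}$: $\Omega_{max}$ is the set of all $w\in\mathbb{C}$ such that the functional $P\mapsto P(w)$ on $\mathcal{P}_1$ extends to a continuous linear functional on $\mathcal{H}$. *)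

theory Defs
  imports "HOL-Analysis.Analysis" "HOL-Computational_Algebra.Polynomial"
begin

abbreviation unit_disc :: "complex set" (\<open>\<bbbD>\<close>)
  where "\<bbbD> \<equiv> ball 0 1"

abbreviation unit_circle :: "complex set" (\<open>\<bbbT>\<close>)
  where "\<bbbT> \<equiv> sphere 0 1"

text \<open>
  A function on the disc is represented by the total function that vanishes off the disc, so that
  equality of representatives is equality on the disc and pointwise operations stay within
  the representatives.
\<close>

definition Hol_disc :: "(complex \<Rightarrow> complex) set"
  where "Hol_disc = {F. F holomorphic_on \<bbbD> \<and> (\<forall>z. z \<notin> \<bbbD> \<longrightarrow> F z = 0)}"

definition disc_poly :: "complex poly \<Rightarrow> complex \<Rightarrow> complex"
  where "disc_poly p = (\<lambda>z. if z \<in> \<bbbD> then poly p z else 0)"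

text \<open>
  The value off \<^term>\<open>H\<close> is irrelevant; it is fixed because \<^locale>\<open>Metric_space\<close> asks for
  nonnegativity and symmetry on the whole type.
\<close>

definition ip_dist ::
    "(complex \<Rightarrow> complex) set \<Rightarrow> ((complex \<Rightarrow> complex) \<Rightarrow> (complex \<Rightarrow> complex) \<Rightarrow> complex) \<Rightarrow>
     (complex \<Rightarrow> complex) \<Rightarrow> (complex \<Rightarrow> complex) \<Rightarrow> real"
  where "ip_dist H ip F G =
    (if F \<in> H \<and> G \<in> H then sqrt (Re (ip (\<lambda>z. F z - G z) (\<lambda>z. F z - G z))) else 0)"

locale hol_inner_product_space =
  fixes H :: "(complex \<Rightarrow> complex) set"
    and ip :: "(complex \<Rightarrow> complex) \<Rightarrow> (complex \<Rightarrow> complex) \<Rightarrow> complex"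
  assumes subset_Hol: "H \<subseteq> Hol_disc"
    and zero_mem: "(\<lambda>z. 0) \<in> H"
    and add_mem: "\<And>F G. F \<in> H \<Longrightarrow> G \<in> H \<Longrightarrow> (\<lambda>z. F z + G z) \<in> H"
    and scale_mem: "\<And>c F. F \<in> H \<Longrightarrow> (\<lambda>z. c * F z) \<in> H"
    and ip_add: "\<And>F G K. F \<in> H \<Longrightarrow> G \<in> H \<Longrightarrow> K \<in> H \<Longrightarrow>
                   ip (\<lambda>z. F z + G z) K = ip F K + ip G K"
    and ip_scale: "\<And>c F G. F \<in> H \<Longrightarrow> G \<in> H \<Longrightarrow> ip (\<lambda>z. c * F z) G = c * ip F G"
    and ip_commute: "\<And>F G. F \<in> H \<Longrightarrow> G \<in> H \<Longrightarrow> ip G F = cnj (ip F G)"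
    and ip_nonneg: "\<And>F. F \<in> H \<Longrightarrow> 0 \<le> Re (ip F F)"
    and ip_definite: "\<And>F. F \<in> H \<Longrightarrow> ip F F = 0 \<Longrightarrow> F = (\<lambda>z. 0)"
begin

lemma diff_mem: "F \<in> H \<Longrightarrow> G \<in> H \<Longrightarrow> (\<lambda>z. F z - G z) \<in> H"
  using add_mem[of F "\<lambda>z. (-1) * G z"] scale_mem[of G "-1"] by simp

lemma Re_ip_add:
  assumes "F \<in> H" "G \<in> H"
  shows "Re (ip (\<lambda>z. F z + G z) (\<lambda>z. F z + G z)) = Re (ip F F) + 2 * Re (ip F G) + Re (ip G G)"
proof -
  have "ip F (\<lambda>z. F z + G z) = ip F F + ip F G" "ip G (\<lambda>z. F z + G z) = ip G F + ip G G"
    using assms by (simp_all add: ip_commute[of "\<lambda>z. F z + G z"] add_mem ip_add flip: ip_commute)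
  then show ?thesis
    using assms by (simp add: ip_add add_mem ip_commute[of F G])
qed

lemma Re_ip_scale:
  assumes "F \<in> H"
  shows "Re (ip (\<lambda>z. of_real c * F z) (\<lambda>z. of_real c * F z)) = c\<^sup>2 * Re (ip F F)"
  using assms
  by (simp add: ip_scale scale_mem ip_commute[of "\<lambda>z. of_real c * F z" F] power2_eq_square)

lemma Re_ip_le:
  assumes F: "F \<in> H" and G: "G \<in> H"
  shows "Re (ip F G) \<le> sqrt (Re (ip F F)) * sqrt (Re (ip G G))"
proof (cases "G = (\<lambda>z. 0)")
  case True
  have "ip G F = 0"
    using ip_scale[OF G F, of 0] True by simp
  then have "ip F G = 0"
    using ip_commute[OF G F] by simp
  then show ?thesis
    by (simp add: F G ip_nonneg)
next
  case False
  define A B C where "A = Re (ip F F)" and "B = Re (ip F G)" and "C = Re (ip G G)"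
  have "Im (ip G G) = 0"
    using ip_commute[OF G G] by (simp add: complex_eq_iff)
  then have "C \<noteq> 0"
    using ip_definite[OF G] False by (auto simp: C_def complex_eq_iff)
  then have C: "C > 0"
    using ip_nonneg[OF G] by (simp add: C_def)
  have "Re (ip F (\<lambda>z. of_real c * G z)) = c * B" for c
    using ip_commute[of "\<lambda>z. of_real c * G z" F] ip_commute[of G F] F G
    by (simp add: scale_mem ip_scale B_def)
  then have "0 \<le> A + 2 * (c * B) + c\<^sup>2 * C" for c
    using ip_nonneg[OF add_mem[OF F scale_mem[OF G, of "of_real c"]]] F G
    by (simp add: Re_ip_add Re_ip_scale scale_mem A_def C_def)
  from this[of "- B / C"] have "B\<^sup>2 \<le> A * C"
    using C by (simp add: field_simps power2_eq_square)
  then have "B \<le> sqrt (A * C)"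
    using real_le_rsqrt by blast
  then show ?thesis
    by (simp add: A_def B_def C_def real_sqrt_mult)
qed

sublocale Metric_space H "ip_dist H ip"
proof
  fix F G
  show "0 \<le> ip_dist H ip F G"
    by (simp add: ip_dist_def ip_nonneg diff_mem)
  show "ip_dist H ip F G = ip_dist H ip G F"
    using Re_ip_scale[OF diff_mem, of F G "-1"] by (simp add: ip_dist_def)
next
  fix F G assume FG: "F \<in> H" "G \<in> H"
  show "ip_dist H ip F G = 0 \<longleftrightarrow> F = G"
  proof
    assume "ip_dist H ip F G = 0"
    moreover have "Im (ip (\<lambda>z. F z - G z) (\<lambda>z. F z - G z)) = 0"
      using ip_commute[OF diff_mem diff_mem, OF FG FG] by (simp add: complex_eq_iff)
    ultimately have "ip (\<lambda>z. F z - G z) (\<lambda>z. F z - G z) = 0"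
      using FG by (simp add: ip_dist_def complex_eq_iff)
    then have "(\<lambda>z. F z - G z) = (\<lambda>z. 0)"
      by (rule ip_definite[OF diff_mem[OF FG]])
    then show "F = G"
      by (simp add: fun_eq_iff)
  next
    assume "F = G"
    then show "ip_dist H ip F G = 0"
      using ip_scale[OF zero_mem zero_mem, of 0] by (simp add: ip_dist_def)
  qed
next
  fix F G K assume FGK: "F \<in> H" "G \<in> H" "K \<in> H"
  let ?f = "\<lambda>z. F z - G z" and ?g = "\<lambda>z. G z - K z"
  have m: "?f \<in> H" "?g \<in> H"
    using FGK by (auto intro: diff_mem)
  have "Re (ip (\<lambda>z. ?f z + ?g z) (\<lambda>z. ?f z + ?g z))
          \<le> (sqrt (Re (ip ?f ?f)) + sqrt (Re (ip ?g ?g)))\<^sup>2"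
    unfolding Re_ip_add[OF m] using Re_ip_le[OF m] ip_nonneg[OF m(1)] ip_nonneg[OF m(2)]
    by (simp add: power2_sum)
  then have "sqrt (Re (ip (\<lambda>z. ?f z + ?g z) (\<lambda>z. ?f z + ?g z)))
          \<le> sqrt (Re (ip ?f ?f)) + sqrt (Re (ip ?g ?g))"
    by (rule real_le_lsqrt[rotated]) (simp add: ip_nonneg m)
  then show "ip_dist H ip F K \<le> ip_dist H ip F G + ip_dist H ip G K"
    using FGK by (simp add: ip_dist_def)
qed

end

locale hol_hilbert_space = hol_inner_product_space +
  assumes complete: "mcomplete"

definition ip_topology ::
    "(complex \<Rightarrow> complex) set \<Rightarrow> ((complex \<Rightarrow> complex) \<Rightarrow> (complex \<Rightarrow> complex) \<Rightarrow> complex) \<Rightarrow>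
     (complex \<Rightarrow> complex) topology"
  where "ip_topology H ip = Metric_space.mtopology H (ip_dist H ip)"

definition polynomials_dense ::
    "(complex \<Rightarrow> complex) set \<Rightarrow> ((complex \<Rightarrow> complex) \<Rightarrow> (complex \<Rightarrow> complex) \<Rightarrow> complex) \<Rightarrow> bool"
  where "polynomials_dense H ip \<longleftrightarrow>
    range disc_poly \<subseteq> H \<and> ip_topology H ip closure_of range disc_poly = H"

definition evaluations_continuous ::
    "(complex \<Rightarrow> complex) set \<Rightarrow> ((complex \<Rightarrow> complex) \<Rightarrow> (complex \<Rightarrow> complex) \<Rightarrow> complex) \<Rightarrow> bool"
  where "evaluations_continuous H ip \<longleftrightarrow>
    (\<forall>w\<in>\<bbbD>. continuous_map (ip_topology H ip) euclidean (\<lambda>F. F w))"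

definition shift :: "(complex \<Rightarrow> complex) \<Rightarrow> complex \<Rightarrow> complex"
  where "shift F = (\<lambda>z. z * F z)"

definition shift_continuous ::
    "(complex \<Rightarrow> complex) set \<Rightarrow> ((complex \<Rightarrow> complex) \<Rightarrow> (complex \<Rightarrow> complex) \<Rightarrow> complex) \<Rightarrow> bool"
  where "shift_continuous H ip \<longleftrightarrow>
    shift ` H \<subseteq> H \<and> continuous_map (ip_topology H ip) (ip_topology H ip) shift"

definition linear_functional_on ::
    "(complex \<Rightarrow> complex) set \<Rightarrow> ((complex \<Rightarrow> complex) \<Rightarrow> complex) \<Rightarrow> bool"
  where "linear_functional_on H L \<longleftrightarrow>
    (\<forall>F\<in>H. \<forall>G\<in>H. L (\<lambda>z. F z + G z) = L F + L G) \<and> (\<forall>c. \<forall>F\<in>H. L (\<lambda>z. c * F z) = c * L F)"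

definition Omega_max ::
    "(complex \<Rightarrow> complex) set \<Rightarrow> ((complex \<Rightarrow> complex) \<Rightarrow> (complex \<Rightarrow> complex) \<Rightarrow> complex) \<Rightarrow> complex set"
  where "Omega_max H ip = {w. \<exists>L. linear_functional_on H L \<and>
    continuous_map (ip_topology H ip) euclidean L \<and> (\<forall>p. L (disc_poly p) = poly p w)}"

end

theory Submission
  imports Defs "HOL-Complex_Analysis.Complex_Analysis"
begin

text \<open>
  Write \<open>\<Gamma> = (\<Union>n. K n)\<close> and \<open>\<bbbT> - \<Gamma> = (\<Union>p. L p)\<close> with compact \<open>K n\<close> and increasing compact \<open>L p\<close>; then
  every \<open>K n\<close> has positive distance from every \<open>L p\<close>.  The norm is

    \<open>\<parallel>F\<parallel>\<^sup>2 = (\<Sum>k. |a\<^sub>k|\<^sup>2) + (\<Sum>j. c\<^sub>j (|F x\<^sub>j - F y\<^sub>j|\<^sup>2 + |x\<^sub>j - y\<^sub>j|\<^sup>2 |F y\<^sub>j|\<^sup>2))\<close>,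

  where the \<open>a\<^sub>k\<close> are the Taylor coefficients of \<open>F\<close>, and \<open>x\<^sub>j\<close>, \<open>y\<^sub>j\<close> are consecutive points, on radii that
  increase to \<open>1\<close>, on the rays through a finite net of \<open>K n\<close>.  The space is the closure of the polynomials in the
  space of all holomorphic functions of finite norm, so density and completeness are automatic, and the shift is
  bounded because \<open>x F x - y F y = x (F x - F y) + (x - y) F y\<close>.

  For \<open>w \<in> K n\<close> the radial increments of \<open>F\<close> at \<open>w\<close> are summable: they differ from those at a net
  point by a Hardy space Lipschitz estimate, and those at the net points are controlled by the norm.  Points of a net of
  mesh \<open>(1 - r)\<^bsup>3/2\<^esup>\<close> are needed at radius \<open>r\<close>, while polynomials have finite norm as long as there are
  fewer than \<open>(1 - r)\<^bsup>-2\<^esup>\<close> of them.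

  For \<open>w \<in> L p\<close> the squares of the means \<open>N\<^sup>-\<^sup>1 (\<Sum>k<N. (cnj w z)\<^sup>k)\<close> have value \<open>1\<close> at \<open>w\<close>, and their
  norm contributions from the Taylor coefficients and from \<open>K 0, \<dots>, K p\<close> tend to \<open>0\<close> as \<open>N \<rightarrow> \<infinity>\<close>.  So \<open>N p\<close> can be
  chosen from these sets alone, and afterwards the weight of \<open>K n\<close> is made small in terms of
  \<open>N 0, \<dots>, N n\<close>; then the evaluation at \<open>w\<close> is unbounded.
\<close>

section \<open>Closure of the polynomials for a sum of squares of functionals\<close>

lemma Hol_disc_add: "F \<in> Hol_disc \<Longrightarrow> G \<in> Hol_disc \<Longrightarrow> (\<lambda>z. F z + G z) \<in> Hol_disc"
  and Hol_disc_scale: "F \<in> Hol_disc \<Longrightarrow> (\<lambda>z. c * F z) \<in> Hol_disc"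
  and Hol_disc_diff: "F \<in> Hol_disc \<Longrightarrow> G \<in> Hol_disc \<Longrightarrow> (\<lambda>z. F z - G z) \<in> Hol_disc"
  by (auto simp: Hol_disc_def intro!: holomorphic_intros)

lemma Hol_disc_0: "(\<lambda>z. 0) \<in> Hol_disc"
  by (auto simp: Hol_disc_def)

lemma shift_Hol_disc: "F \<in> Hol_disc \<Longrightarrow> shift F \<in> Hol_disc"
  by (auto simp: Hol_disc_def shift_def intro!: holomorphic_intros)

lemma poly_holomorphic_on: "poly p holomorphic_on A" for p :: "complex poly"
  by (intro holomorphic_onI) (metis DERIV_subset poly_DERIV field_differentiable_def top_greatest)

lemma disc_poly_Hol_disc: "disc_poly p \<in> Hol_disc"
  unfolding Hol_disc_def disc_poly_def
  by (auto intro: holomorphic_transform[OF poly_holomorphic_on])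

lemma disc_poly_add: "(\<lambda>z. disc_poly p z + disc_poly q z) = disc_poly (p + q)"
  and disc_poly_scale: "(\<lambda>z. c * disc_poly p z) = disc_poly (smult c p)"
  and shift_disc_poly: "shift (disc_poly p) = disc_poly (pCons 0 p)"
  by (auto simp: disc_poly_def shift_def fun_eq_iff)

section \<open>Energies and the closure of the polynomials\<close>

text \<open>A divergent infinite sum has value 0 here, so \<open>energy\<close> is informative only
  for members of \<open>finite_energy\<close>; this is why membership accompanies the
  estimates.\<close>

definition energy :: "'i set \<Rightarrow> ('i \<Rightarrow> (complex \<Rightarrow> complex) \<Rightarrow> complex) \<Rightarrow> (complex \<Rightarrow> complex) \<Rightarrow> real"
  where "energy I l F = (\<Sum>\<^sub>\<infinity>i\<in>I. (norm (l i F))\<^sup>2)"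

definition finite_energy :: "'i set \<Rightarrow> ('i \<Rightarrow> (complex \<Rightarrow> complex) \<Rightarrow> complex) \<Rightarrow> (complex \<Rightarrow> complex) set"
  where "finite_energy I l = {F \<in> Hol_disc. (\<lambda>i. (norm (l i F))\<^sup>2) summable_on I}"

lemma energy_nonneg: "0 \<le> energy I l F"
  unfolding energy_def by (rule infsum_nonneg) auto

lemma finite_sum_le_energy:
  assumes "F \<in> finite_energy I l" "finite S" "S \<subseteq> I"
  shows "(\<Sum>i\<in>S. (norm (l i F))\<^sup>2) \<le> energy I l F"
  unfolding energy_def using assms by (intro finite_sum_le_infsum) (auto simp: finite_energy_def)

lemma finite_energyI:
  assumes "F \<in> Hol_disc" "\<And>S. finite S \<Longrightarrow> S \<subseteq> I \<Longrightarrow> (\<Sum>i\<in>S. (norm (l i F))\<^sup>2) \<le> B"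
  shows "F \<in> finite_energy I l" "energy I l F \<le> B"
proof -
  have s: "(\<lambda>i. (norm (l i F))\<^sup>2) summable_on I"
    by (rule nonneg_bdd_above_summable_on) (auto simp: bdd_above_def intro!: exI[of _ B] assms(2))
  then show "F \<in> finite_energy I l"
    using assms(1) by (auto simp: finite_energy_def)
  show "energy I l F \<le> B"
    unfolding energy_def by (rule infsum_le_finite_sums[OF s]) (auto intro: assms(2))
qed

definition energy_ip ::
    "'i set \<Rightarrow> ('i \<Rightarrow> (complex \<Rightarrow> complex) \<Rightarrow> complex) \<Rightarrow> (complex \<Rightarrow> complex) \<Rightarrow> (complex \<Rightarrow> complex) \<Rightarrow> complex"
  where "energy_ip I l F G = (\<Sum>\<^sub>\<infinity>i\<in>I. l i F * cnj (l i G))"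

text \<open>The closure is phrased through the energy because the metric \<open>ip_dist\<close>
  becomes available only after this set is known to be an inner product space.\<close>

definition poly_closure :: "'i set \<Rightarrow> ('i \<Rightarrow> (complex \<Rightarrow> complex) \<Rightarrow> complex) \<Rightarrow> (complex \<Rightarrow> complex) set"
  where "poly_closure I l =
    {F \<in> finite_energy I l. \<forall>e>0. \<exists>p. energy I l (\<lambda>z. F z - disc_poly p z) < e}"

text \<open>\<open>eval_bound\<close> turns Cauchy sequences in energy into locally uniformly Cauchy
  ones, and \<open>l_continuous\<close> lets each functional pass to the limit; together they give
  completeness. \<open>eval_bound\<close> also yields P2, and \<open>shift_bound\<close> yields
  P3.\<close>

locale energy_space =
  fixes I :: "'i set" and l :: "'i \<Rightarrow> (complex \<Rightarrow> complex) \<Rightarrow> complex"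
  assumes l_add: "\<And>i F G. i \<in> I \<Longrightarrow> F \<in> Hol_disc \<Longrightarrow> G \<in> Hol_disc \<Longrightarrow>
      l i (\<lambda>z. F z + G z) = l i F + l i G"
    and l_scale: "\<And>i c F. i \<in> I \<Longrightarrow> F \<in> Hol_disc \<Longrightarrow> l i (\<lambda>z. c * F z) = c * l i F"
    and l_continuous: "\<And>i f F. i \<in> I \<Longrightarrow> (\<And>n. f n \<in> Hol_disc) \<Longrightarrow> F \<in> Hol_disc \<Longrightarrow>
      (\<And>r. r < 1 \<Longrightarrow> uniform_limit (cball 0 r) f F sequentially) \<Longrightarrow> (\<lambda>n. l i (f n)) \<longlonglongrightarrow> l i F"
    and eval_bound: "\<And>r. r < 1 \<Longrightarrow> \<exists>C. \<forall>F\<in>finite_energy I l. \<forall>z\<in>cball 0 r.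
      (norm (F z))\<^sup>2 \<le> C * energy I l F"
    and poly_mem: "\<And>p. disc_poly p \<in> finite_energy I l"
    and shift_bound: "\<exists>C. \<forall>F\<in>finite_energy I l.
      shift F \<in> finite_energy I l \<and> energy I l (shift F) \<le> C * energy I l F"
begin

abbreviation "X \<equiv> finite_energy I l"
abbreviation "nsq \<equiv> energy I l"
abbreviation "ip \<equiv> energy_ip I l"
abbreviation "H \<equiv> poly_closure I l"

lemma X_Hol: "F \<in> X \<Longrightarrow> F \<in> Hol_disc"
  and X_summable: "F \<in> X \<Longrightarrow> (\<lambda>i. (norm (l i F))\<^sup>2) summable_on I"
  by (auto simp: finite_energy_def)

text \<open>The factor 2 comes from
  \<open>(a + b)\<^sup>2 \<le> 2 * a\<^sup>2 + 2 * b\<^sup>2\<close>. This weak triangle inequality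
  suffices for the closure arguments made before the inner product is set up.\<close>

lemma X_add:
  assumes "F \<in> X" "G \<in> X"
  shows "(\<lambda>z. F z + G z) \<in> X" and "nsq (\<lambda>z. F z + G z) \<le> 2 * nsq F + 2 * nsq G"
proof -
  note h = assms[THEN X_Hol]
  have "(\<Sum>i\<in>S. (norm (l i (\<lambda>z. F z + G z)))\<^sup>2) \<le> 2 * nsq F + 2 * nsq G"
    if S: "finite S" "S \<subseteq> I" for S
  proof -
    have "(norm (l i (\<lambda>z. F z + G z)))\<^sup>2 \<le> 2 * (norm (l i F))\<^sup>2 + 2 * (norm (l i G))\<^sup>2" if "i \<in> S" for i
    proof -
      have "(norm (l i (\<lambda>z. F z + G z)))\<^sup>2 \<le> (norm (l i F) + norm (l i G))\<^sup>2"
        using that S h by (auto simp: l_add intro!: power_mono norm_triangle_ineq)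
      also have "\<dots> \<le> 2 * (norm (l i F))\<^sup>2 + 2 * (norm (l i G))\<^sup>2"
        using zero_le_power2[of "norm (l i F) - norm (l i G)"]
        by (simp add: power2_eq_square algebra_simps)
      finally show ?thesis .
    qed
    then have "(\<Sum>i\<in>S. (norm (l i (\<lambda>z. F z + G z)))\<^sup>2)
        \<le> (\<Sum>i\<in>S. 2 * (norm (l i F))\<^sup>2 + 2 * (norm (l i G))\<^sup>2)"
      by (rule sum_mono)
    also have "\<dots> \<le> 2 * nsq F + 2 * nsq G"
      using finite_sum_le_energy[OF assms(1) S] finite_sum_le_energy[OF assms(2) S]
      by (simp add: sum.distrib flip: sum_distrib_left)
    finally show ?thesis .
  qed
  then show "(\<lambda>z. F z + G z) \<in> X" "nsq (\<lambda>z. F z + G z) \<le> 2 * nsq F + 2 * nsq G"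
    by - (rule finite_energyI[OF Hol_disc_add[OF h]]; assumption)+
qed

lemma nsq_scale:
  assumes "F \<in> Hol_disc"
  shows "nsq (\<lambda>z. c * F z) = (norm c)\<^sup>2 * nsq F"
proof -
  have "nsq (\<lambda>z. c * F z) = (\<Sum>\<^sub>\<infinity>i\<in>I. (norm c)\<^sup>2 * (norm (l i F))\<^sup>2)"
    unfolding energy_def
    by (rule infsum_cong) (use assms in \<open>simp add: l_scale norm_mult power_mult_distrib\<close>)
  then show ?thesis
    by (simp add: energy_def infsum_cmult_right')
qed

lemma X_scale:
  assumes "F \<in> X"
  shows "(\<lambda>z. c * F z) \<in> X"
proof -
  have "(\<lambda>i. (norm (l i (\<lambda>z. c * F z)))\<^sup>2) summable_on I \<longleftrightarrow>
      (\<lambda>i. (norm c)\<^sup>2 * (norm (l i F))\<^sup>2) summable_on I"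
    by (rule summable_on_cong) (use assms X_Hol in \<open>simp add: l_scale norm_mult power_mult_distrib\<close>)
  then show ?thesis
    using assms by (auto simp: finite_energy_def Hol_disc_scale intro: summable_on_cmult_right)
qed

lemma X_diff:
  assumes "F \<in> X" "G \<in> X"
  shows "(\<lambda>z. F z - G z) \<in> X" and "nsq (\<lambda>z. F z - G z) \<le> 2 * nsq F + 2 * nsq G"
  using X_add[OF assms(1) X_scale[OF assms(2), of "-1"]] nsq_scale[OF X_Hol[OF assms(2)], of "-1"]
  by simp_all

lemma nsq_diff_commute:
  assumes "F \<in> X" "G \<in> X"
  shows "nsq (\<lambda>z. F z - G z) = nsq (\<lambda>z. G z - F z)"
  using nsq_scale[OF X_Hol[OF X_diff(1)[OF assms]], of "-1"] by simp

lemma l_diff: "i \<in> I \<Longrightarrow> F \<in> Hol_disc \<Longrightarrow> G \<in> Hol_disc \<Longrightarrow> l i (\<lambda>z. F z - G z) = l i F - l i G"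
  using l_add[of i F "\<lambda>z. (-1) * G z"] l_scale[of i G "-1"] Hol_disc_scale[of G "-1"] by simp

lemma ip_summable:
  assumes "F \<in> X" "G \<in> X"
  shows "(\<lambda>i. l i F * cnj (l i G)) summable_on I"
proof (rule abs_summable_summable, rule summable_on_comparison_test)
  show "(\<lambda>i. (norm (l i F))\<^sup>2 + (norm (l i G))\<^sup>2) summable_on I"
    using assms by (intro summable_on_add X_summable)
  fix i
  have "norm (l i F) * norm (l i G) \<le> (norm (l i F))\<^sup>2 + (norm (l i G))\<^sup>2"
    using sum_squares_bound[of "norm (l i F)" "norm (l i G)"]
      mult_nonneg_nonneg[of "norm (l i F)" "norm (l i G)", OF norm_ge_zero norm_ge_zero] by linarith
  then show "norm (l i F * cnj (l i G)) \<le> (norm (l i F))\<^sup>2 + (norm (l i G))\<^sup>2"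
    by (simp add: norm_mult)
qed auto

lemma ip_self:
  assumes "F \<in> X"
  shows "ip F F = of_real (nsq F)"
proof -
  have "ip F F = (\<Sum>\<^sub>\<infinity>i\<in>I. of_real ((norm (l i F))\<^sup>2))"
    unfolding energy_ip_def by (rule infsum_cong) (simp only: complex_norm_square)
  also have "\<dots> = of_real (nsq F)"
    unfolding energy_def using X_summable[OF assms] by (intro infsumI has_sum_of_real) simp
  finally show ?thesis .
qed

lemma point_eval_bound:
  assumes "w \<in> \<bbbD>"
  shows "\<exists>C. \<forall>F\<in>X. (norm (F w))\<^sup>2 \<le> C * nsq F"
proof -
  obtain C where "\<forall>F\<in>X. \<forall>z\<in>cball 0 (norm w). (norm (F z))\<^sup>2 \<le> C * nsq F"
    using eval_bound[of "norm w"] assms by auto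
  then show ?thesis by (intro exI[of _ C]) simp
qed

lemma nsq_eq_0:
  assumes "F \<in> X" "nsq F = 0"
  shows "F = (\<lambda>z. 0)"
proof
  fix z
  show "F z = 0"
  proof (cases "z \<in> \<bbbD>")
    case True
    then obtain C where "(norm (F z))\<^sup>2 \<le> C * nsq F"
      using point_eval_bound assms by blast
    then show ?thesis using assms by simp
  qed (use X_Hol[OF assms(1)] in \<open>simp add: Hol_disc_def\<close>)
qed

lemma H_X: "F \<in> H \<Longrightarrow> F \<in> X"
  by (simp add: poly_closure_def)

lemma H_approx: "F \<in> H \<Longrightarrow> e > 0 \<Longrightarrow> \<exists>p. nsq (\<lambda>z. F z - disc_poly p z) < e"
  by (simp add: poly_closure_def)

lemma poly_H: "disc_poly p \<in> H"
  unfolding poly_closure_def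
  using poly_mem nsq_scale[OF Hol_disc_0, of 0] by (auto intro!: exI[of _ p])

lemma zero_H: "(\<lambda>z. 0) \<in> H"
  using poly_H[of 0] by (simp add: disc_poly_def cong: if_cong)

lemma H_closed:
  assumes "F \<in> X" "\<And>e. e > 0 \<Longrightarrow> \<exists>G\<in>H. nsq (\<lambda>z. F z - G z) < e"
  shows "F \<in> H"
  unfolding poly_closure_def
proof safe
  fix e :: real assume e: "e > 0"
  obtain G where G: "G \<in> H" "nsq (\<lambda>z. F z - G z) < e / 4"
    using assms(2)[of "e / 4"] e by auto
  obtain p where p: "nsq (\<lambda>z. G z - disc_poly p z) < e / 4"
    using H_approx[OF G(1), of "e / 4"] e by auto
  have "nsq (\<lambda>z. F z - disc_poly p z) \<le> 2 * nsq (\<lambda>z. F z - G z) + 2 * nsq (\<lambda>z. G z - disc_poly p z)"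
    using X_add(2)[OF X_diff(1)[OF assms(1) H_X[OF G(1)]] X_diff(1)[OF H_X[OF G(1)] poly_mem]] by simp
  then show "\<exists>p. nsq (\<lambda>z. F z - disc_poly p z) < e"
    using G p by (intro exI[of _ p]) linarith
qed (rule assms(1))

lemma H_add:
  assumes "F \<in> H" "G \<in> H"
  shows "(\<lambda>z. F z + G z) \<in> H"
  unfolding poly_closure_def
proof safe
  note X = assms[THEN H_X]
  show "(\<lambda>z. F z + G z) \<in> X"
    by (rule X_add(1)[OF X])
  fix e :: real assume e: "e > 0"
  obtain p where p: "nsq (\<lambda>z. F z - disc_poly p z) < e / 4"
    using H_approx[OF assms(1), of "e / 4"] e by auto
  obtain q where q: "nsq (\<lambda>z. G z - disc_poly q z) < e / 4"
    using H_approx[OF assms(2), of "e / 4"] e by auto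
  have "(\<lambda>z. F z + G z - disc_poly (p + q) z) = (\<lambda>z. (F z - disc_poly p z) + (G z - disc_poly q z))"
    by (auto simp flip: disc_poly_add)
  then have "nsq (\<lambda>z. F z + G z - disc_poly (p + q) z)
      \<le> 2 * nsq (\<lambda>z. F z - disc_poly p z) + 2 * nsq (\<lambda>z. G z - disc_poly q z)"
    using X_add(2)[OF X_diff(1)[OF X(1) poly_mem] X_diff(1)[OF X(2) poly_mem]] by simp
  then show "\<exists>p. nsq (\<lambda>z. F z + G z - disc_poly p z) < e"
    using p q by (intro exI[of _ "p + q"]) linarith
qed

text \<open>Common to scalar multiplication and the shift: a bounded operator sending polynomials to
  polynomials sends approximants of \<open>F\<close> to approximants of \<open>T F\<close>.\<close>

lemma H_bounded_image:
  assumes F: "F \<in> H"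
    and T: "\<And>G. G \<in> X \<Longrightarrow> T G \<in> X \<and> nsq (T G) \<le> C * nsq G"
    and T_diff: "\<And>G K. (\<lambda>z. T G z - T K z) = T (\<lambda>z. G z - K z)"
    and T_poly: "\<And>p. \<exists>q. T (disc_poly p) = disc_poly q"
  shows "T F \<in> H"
  unfolding poly_closure_def
proof safe
  show "T F \<in> X" using T F H_X by auto
  fix e :: real assume e: "e > 0"
  \<comment> \<open>\<open>C\<close> may be 0 or negative, whereas the tolerance is divided by the
    constant.\<close>
  define D where "D = max C 1"
  obtain p where p: "nsq (\<lambda>z. F z - disc_poly p z) < e / D"
    using H_approx[OF F, of "e / D"] e by (auto simp: D_def)
  obtain q where q: "T (disc_poly p) = disc_poly q" using T_poly by blast
  have "nsq (\<lambda>z. T F z - disc_poly q z) \<le> C * nsq (\<lambda>z. F z - disc_poly p z)"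
    using T[OF X_diff(1)[OF H_X[OF F] poly_mem]] by (simp add: T_diff flip: q)
  also have "\<dots> \<le> D * nsq (\<lambda>z. F z - disc_poly p z)"
    by (rule mult_right_mono) (auto simp: D_def energy_nonneg)
  also have "\<dots> < D * (e / D)"
    using p by (intro mult_strict_left_mono) (auto simp: D_def)
  also have "\<dots> = e" by (simp add: D_def)
  finally show "\<exists>p. nsq (\<lambda>z. T F z - disc_poly p z) < e" by blast
qed

lemma H_scale: "F \<in> H \<Longrightarrow> (\<lambda>z. c * F z) \<in> H"
proof -
  assume F: "F \<in> H"
  show ?thesis
  proof (rule H_bounded_image[where T = "\<lambda>F z. c * F z", OF F])
    show "(\<lambda>z. c * G z) \<in> X \<and> nsq (\<lambda>z. c * G z) \<le> (norm c)\<^sup>2 * nsq G" if "G \<in> X" for G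
      using that X_scale nsq_scale[OF X_Hol] by simp
    show "(\<lambda>z. c * G z - c * K z) = (\<lambda>z. c * (G z - K z))" for G K
      by (simp add: right_diff_distrib)
    show "\<exists>q. (\<lambda>z. c * disc_poly p z) = disc_poly q" for p
      using disc_poly_scale by blast
  qed
qed

lemma H_shift: "F \<in> H \<Longrightarrow> shift F \<in> H"
proof -
  assume F: "F \<in> H"
  obtain C where C: "\<forall>F\<in>X. shift F \<in> X \<and> nsq (shift F) \<le> C * nsq F"
    using shift_bound by (elim exE)
  show ?thesis
  proof (rule H_bounded_image[where T = shift, OF F C[rule_format]])
    show "(\<lambda>z. shift G z - shift K z) = shift (\<lambda>z. G z - K z)" for G K
      by (auto simp: shift_def algebra_simps)
  qed (auto simp: shift_disc_poly)
qed

sublocale hol_inner_product_space H ip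
proof
  show "H \<subseteq> Hol_disc" using H_X X_Hol by auto
  show "(\<lambda>z. 0) \<in> H" by (rule zero_H)
next
  fix F G assume FG: "F \<in> H" "G \<in> H"
  show "(\<lambda>z. F z + G z) \<in> H" by (rule H_add[OF FG])
next
  fix F G K assume FGK: "F \<in> H" "G \<in> H" "K \<in> H"
  note X = FGK[THEN H_X]
  have "ip (\<lambda>z. F z + G z) K = (\<Sum>\<^sub>\<infinity>i\<in>I. l i F * cnj (l i K) + l i G * cnj (l i K))"
    unfolding energy_ip_def
    by (rule infsum_cong) (use X X_Hol in \<open>simp add: l_add algebra_simps\<close>)
  then show "ip (\<lambda>z. F z + G z) K = ip F K + ip G K"
    unfolding energy_ip_def using X by (simp add: infsum_add ip_summable)
next
  fix c F assume "F \<in> H"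
  then show "(\<lambda>z. c * F z) \<in> H" by (rule H_scale)
next
  fix c F G assume FG: "F \<in> H" "G \<in> H"
  note X = FG[THEN H_X]
  have "ip (\<lambda>z. c * F z) G = (\<Sum>\<^sub>\<infinity>i\<in>I. c * (l i F * cnj (l i G)))"
    unfolding energy_ip_def
    by (rule infsum_cong) (use X X_Hol in \<open>simp add: l_scale algebra_simps\<close>)
  then show "ip (\<lambda>z. c * F z) G = c * ip F G"
    by (simp add: energy_ip_def infsum_cmult_right')
next
  fix F G assume "F \<in> H" "G \<in> H"
  show "ip G F = cnj (ip F G)"
    unfolding energy_ip_def by (subst infsum_cnj[symmetric], rule infsum_cong) simp
next
  fix F assume F: "F \<in> H"
  show "0 \<le> Re (ip F F)" by (simp add: ip_self H_X F energy_nonneg)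
  assume "ip F F = 0"
  with F show "F = (\<lambda>z. 0)" using nsq_eq_0[OF H_X] by (simp add: ip_self H_X)
qed

lemma ip_dist_eq: "F \<in> H \<Longrightarrow> G \<in> H \<Longrightarrow> ip_dist H ip F G = sqrt (nsq (\<lambda>z. F z - G z))"
  by (simp add: ip_dist_def ip_self H_X X_diff)

lemma ip_dist_less_iff:
  "F \<in> H \<Longrightarrow> G \<in> H \<Longrightarrow> e > 0 \<Longrightarrow> ip_dist H ip F G < e \<longleftrightarrow> nsq (\<lambda>z. F z - G z) < e\<^sup>2"
  using real_sqrt_less_iff[of "nsq (\<lambda>z. F z - G z)" "e\<^sup>2"] by (simp add: ip_dist_eq)

text \<open>Completeness of the whole space \<open>X\<close>, not yet of \<open>H\<close>. The limit
  is taken locally uniformly, and the energy of the difference is recovered by a Fatou argument on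
  finite partial sums.\<close>

lemma energy_limit:
  fixes f :: "nat \<Rightarrow> complex \<Rightarrow> complex"
  assumes f: "\<And>n. f n \<in> X"
    and cauchy: "\<And>e. e > 0 \<Longrightarrow> \<exists>N. \<forall>m\<ge>N. \<forall>n\<ge>N. nsq (\<lambda>z. f m z - f n z) < e"
  shows "\<exists>F\<in>X. \<forall>e>0. \<exists>N. \<forall>n\<ge>N. nsq (\<lambda>z. F z - f n z) \<le> e"
proof -
  have fH: "f n \<in> Hol_disc" for n using f X_Hol by auto
  have ucauchy: "\<exists>N. \<forall>m\<ge>N. \<forall>n\<ge>N. \<forall>z\<in>cball 0 r. dist (f m z) (f n z) < e"
    if r: "r < 1" and e: "e > 0" for r e :: real
  proof -
    obtain C where C: "\<And>F z. F \<in> X \<Longrightarrow> z \<in> cball 0 r \<Longrightarrow> (norm (F z))\<^sup>2 \<le> C * nsq F"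
      using eval_bound[OF r] by blast
    define D where "D = max C 1"
    have D: "D > 0" by (simp add: D_def)
    obtain N where N: "\<And>m n. m \<ge> N \<Longrightarrow> n \<ge> N \<Longrightarrow> nsq (\<lambda>z. f m z - f n z) < e\<^sup>2 / D"
      using cauchy[of "e\<^sup>2 / D"] e D by auto
    have "dist (f m z) (f n z) < e" if "m \<ge> N" "n \<ge> N" "z \<in> cball 0 r" for m n z
    proof -
      have "(norm (f m z - f n z))\<^sup>2 \<le> C * nsq (\<lambda>z. f m z - f n z)"
        by (rule C) (use that X_diff f in auto)
      also have "\<dots> \<le> D * nsq (\<lambda>z. f m z - f n z)"
        by (rule mult_right_mono) (auto simp: D_def energy_nonneg)
      also have "\<dots> < D * (e\<^sup>2 / D)"
        using N that D by (intro mult_strict_left_mono) auto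
      finally have "(norm (f m z - f n z))\<^sup>2 < e\<^sup>2" using D by simp
      then show ?thesis
        using e by (simp add: dist_norm power_less_imp_less_base)
    qed
    then show ?thesis by blast
  qed
  \<comment> \<open>The value 0 off the disc keeps the limit among the representatives in
    \<open>Hol_disc\<close>.\<close>
  define F where "F z = (if z \<in> \<bbbD> then lim (\<lambda>n. f n z) else 0)" for z
  have pointwise: "(\<lambda>n. f n z) \<longlonglongrightarrow> F z" if "z \<in> \<bbbD>" for z
  proof -
    have "Cauchy (\<lambda>n. f n z)"
      unfolding Cauchy_def using ucauchy[of "norm z"] that by fastforce
    then show ?thesis
      using that by (simp add: F_def Cauchy_convergent_iff convergent_LIMSEQ_iff)
  qed
  have ulim: "uniform_limit (cball 0 r) f F sequentially" if r: "r < 1" for r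
    unfolding uniform_limit_iff
  proof safe
    fix e :: real assume e: "e > 0"
    obtain N where N: "\<And>m n z. m \<ge> N \<Longrightarrow> n \<ge> N \<Longrightarrow> z \<in> cball 0 r \<Longrightarrow> dist (f m z) (f n z) < e / 2"
      using ucauchy[OF r half_gt_zero[OF e]] by blast
    have "dist (f n z) (F z) \<le> e / 2" if "n \<ge> N" "z \<in> cball 0 r" for n z
    proof (rule LIMSEQ_le_const2)
      show "(\<lambda>m. dist (f n z) (f m z)) \<longlonglongrightarrow> dist (f n z) (F z)"
        using that r by (intro tendsto_intros pointwise) auto
      show "\<exists>M. \<forall>m\<ge>M. dist (f n z) (f m z) \<le> e / 2"
        using N that less_imp_le by blast
    qed
    then show "\<forall>\<^sub>F n in sequentially. \<forall>z\<in>cball 0 r. dist (f n z) (F z) < e"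
      unfolding eventually_sequentially using e by (force intro!: exI[of _ N])
  qed
  have FH: "F \<in> Hol_disc"
  proof -
    have "F holomorphic_on \<bbbD>"
    proof (rule holomorphic_uniform_sequence)
      show "f n holomorphic_on \<bbbD>" for n using fH by (simp add: Hol_disc_def)
      fix x :: complex assume x: "x \<in> \<bbbD>"
      define d where "d = (1 - norm x) / 2"
      have "cball x d \<subseteq> cball 0 ((1 + norm x) / 2)"
      proof
        fix y assume "y \<in> cball x d"
        then have "norm y \<le> norm x + d"
          by (simp add: dist_norm) (metis add_left_mono norm_minus_commute norm_triangle_sub order_trans)
        then show "y \<in> cball 0 ((1 + norm x) / 2)"
          by (simp add: d_def field_simps)
      qed
      moreover have "(1 + norm x) / 2 < 1" using x by simp
      moreover have "cball 0 ((1 + norm x) / 2) \<subseteq> \<bbbD>"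
        using x by auto
      ultimately show "\<exists>d>0. cball x d \<subseteq> \<bbbD> \<and> uniform_limit (cball x d) f F sequentially"
        using ulim[of "(1 + norm x) / 2"] x
        by (intro exI[of _ d]) (auto simp: d_def intro: uniform_limit_on_subset)
    qed auto
    then show ?thesis by (auto simp: Hol_disc_def F_def)
  qed
  \<comment> \<open>Fatou: for finite \<open>S\<close> and fixed \<open>n\<close>, let
    \<open>m\<close> tend to infinity in the Cauchy bound.\<close>
  have main: "(\<lambda>z. F z - f n z) \<in> X \<and> nsq (\<lambda>z. F z - f n z) \<le> e"
    if N: "\<And>m n. m \<ge> N \<Longrightarrow> n \<ge> N \<Longrightarrow> nsq (\<lambda>z. f m z - f n z) < e" and n: "n \<ge> N" for e N n
  proof -
    have "(\<Sum>i\<in>S. (norm (l i (\<lambda>z. F z - f n z)))\<^sup>2) \<le> e" if S: "finite S" "S \<subseteq> I" for S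
    proof (rule LIMSEQ_le_const2)
      have "(\<lambda>m. \<Sum>i\<in>S. (norm (l i (f m) - l i (f n)))\<^sup>2) \<longlonglongrightarrow> (\<Sum>i\<in>S. (norm (l i F - l i (f n)))\<^sup>2)"
        using S by (intro tendsto_intros l_continuous fH FH ulim) auto
      also have "(\<Sum>i\<in>S. (norm (l i F - l i (f n)))\<^sup>2) = (\<Sum>i\<in>S. (norm (l i (\<lambda>z. F z - f n z)))\<^sup>2)"
        using S fH FH by (intro sum.cong) (auto simp: l_diff)
      finally show "(\<lambda>m. \<Sum>i\<in>S. (norm (l i (f m) - l i (f n)))\<^sup>2) \<longlonglongrightarrow> \<dots>" .
      show "\<exists>M. \<forall>m\<ge>M. (\<Sum>i\<in>S. (norm (l i (f m) - l i (f n)))\<^sup>2) \<le> e"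
      proof (intro exI[of _ N] allI impI)
        fix m assume m: "m \<ge> N"
        have "(\<Sum>i\<in>S. (norm (l i (f m) - l i (f n)))\<^sup>2) = (\<Sum>i\<in>S. (norm (l i (\<lambda>z. f m z - f n z)))\<^sup>2)"
          using S fH by (intro sum.cong) (auto simp: l_diff)
        also have "\<dots> \<le> nsq (\<lambda>z. f m z - f n z)"
          by (rule finite_sum_le_energy[OF _ S]) (use X_diff f in auto)
        finally show "(\<Sum>i\<in>S. (norm (l i (f m) - l i (f n)))\<^sup>2) \<le> e"
          using N[OF m n] by simp
      qed
    qed
    then show ?thesis
      by - (rule conjI; rule finite_energyI[OF Hol_disc_diff[OF FH fH]]; assumption)
  qed
  \<comment> \<open>One difference \<open>F - f N\<close> of finite energy suffices: adding
    \<open>f N\<close> back puts \<open>F\<close> itself in \<open>X\<close>.\<close>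
  obtain N where "\<And>m n. m \<ge> N \<Longrightarrow> n \<ge> N \<Longrightarrow> nsq (\<lambda>z. f m z - f n z) < 1"
    using cauchy[of 1] by auto
  then have "(\<lambda>z. F z - f N z) \<in> X"
    using main[of N 1 N] by simp
  then have "F \<in> X"
    using X_add(1)[OF _ f[of N]] by fastforce
  moreover have "\<exists>N. \<forall>n\<ge>N. nsq (\<lambda>z. F z - f n z) \<le> e" if "e > 0" for e
    using cauchy[OF that] main by meson
  ultimately show ?thesis by blast
qed

lemma H_mcomplete: mcomplete
  unfolding mcomplete_def
proof safe
  fix f assume f: "MCauchy f"
  then have fH: "f n \<in> H" for n by (auto simp: MCauchy_def)
  have "\<exists>N. \<forall>m\<ge>N. \<forall>n\<ge>N. nsq (\<lambda>z. f m z - f n z) < e" if e: "e > 0" for e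
  proof -
    obtain N where "\<forall>m n. N \<le> m \<longrightarrow> N \<le> n \<longrightarrow> ip_dist H ip (f m) (f n) < sqrt e"
      using f real_sqrt_gt_zero[OF e] unfolding MCauchy_def by blast
    then show ?thesis using e by (auto simp: ip_dist_less_iff fH)
  qed
  then obtain F where F: "F \<in> X" "\<And>e. e > 0 \<Longrightarrow> \<exists>N. \<forall>n\<ge>N. nsq (\<lambda>z. F z - f n z) \<le> e"
    using energy_limit[of f] fH H_X by blast
  have "\<exists>G\<in>H. nsq (\<lambda>z. F z - G z) < e" if e: "e > 0" for e
  proof -
    obtain N where "nsq (\<lambda>z. F z - f N z) \<le> e / 2"
      using F(2)[OF half_gt_zero[OF e]] by blast
    then show ?thesis using e fH[of N] by (intro bexI[of _ "f N"]) auto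
  qed
  then have FH: "F \<in> H" by (rule H_closed[OF F(1)])
  show "\<exists>F. limitin mtopology f F sequentially"
    unfolding limitin_metric
  proof (intro exI[of _ F] conjI FH allI impI)
    fix e :: real assume e: "e > 0"
    obtain N where N: "\<And>n. n \<ge> N \<Longrightarrow> nsq (\<lambda>z. F z - f n z) \<le> e\<^sup>2 / 2"
      using F(2)[of "e\<^sup>2 / 2"] e by auto
    have "ip_dist H ip (f n) F < e" if "n \<ge> N" for n
    proof -
      have "nsq (\<lambda>z. F z - f n z) < e\<^sup>2"
        by (rule le_less_trans[OF N[OF that]]) (use e in simp)
      then show ?thesis
        using e by (simp add: ip_dist_less_iff fH FH nsq_diff_commute[OF H_X[OF fH] F(1)])
    qed
    then show "\<forall>\<^sub>F n in sequentially. f n \<in> H \<and> ip_dist H ip (f n) F < e"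
      using fH by (auto simp: eventually_sequentially)
  qed
qed

lemma hilbert: "hol_hilbert_space H ip"
  by unfold_locales (rule H_mcomplete)

lemma dense: "polynomials_dense H ip"
proof -
  have "\<exists>p. disc_poly p \<in> mball F r" if "F \<in> H" "r > 0" for F r
    using H_approx[OF that(1), of "r\<^sup>2"] that poly_H by (auto simp: ip_dist_less_iff)
  then have "mtopology closure_of range disc_poly = H"
    by (auto simp: metric_closure_of)
  then show ?thesis
    using poly_H by (auto simp: polynomials_dense_def ip_topology_def)
qed

section \<open>Bounded functionals and the maximal domain\<close>

lemma functional_continuous:
  assumes lin: "\<And>F G. F \<in> H \<Longrightarrow> G \<in> H \<Longrightarrow> L (\<lambda>z. F z - G z) = L F - L G"
    and bound: "\<And>F. F \<in> H \<Longrightarrow> (norm (L F))\<^sup>2 \<le> C * nsq F"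
  shows "continuous_map (ip_topology H ip) euclidean L"
proof -
  define D where "D = max C 1"
  have D: "D > 0" by (simp add: D_def)
  have "continuous_map mtopology Met_TC.mtopology L"
    unfolding metric_continuous_map[OF Met_TC.Metric_space_axioms]
  proof (intro conjI ballI allI impI)
    fix F and e :: real assume F: "F \<in> H" and e: "e > 0"
    have "dist (L F) (L G) < e" if G: "G \<in> H" "ip_dist H ip F G < e / sqrt D" for G
    proof -
      have "nsq (\<lambda>z. F z - G z) < (e / sqrt D)\<^sup>2"
        using G F e D by (simp add: ip_dist_less_iff)
      then have "D * nsq (\<lambda>z. F z - G z) < e\<^sup>2"
        using D by (simp add: power_divide field_simps)
      moreover have "C * nsq (\<lambda>z. F z - G z) \<le> D * nsq (\<lambda>z. F z - G z)"
        by (rule mult_right_mono) (auto simp: D_def energy_nonneg)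
      ultimately have "(norm (L F - L G))\<^sup>2 < e\<^sup>2"
        using bound[OF diff_mem[OF F G(1)]] lin[OF F G(1)] by simp
      then show ?thesis
        using e by (simp add: dist_norm power_less_imp_less_base)
    qed
    then show "\<exists>\<delta>>0. \<forall>G. G \<in> H \<and> ip_dist H ip F G < \<delta> \<longrightarrow> dist (L F) (L G) < e"
      using e D by (intro exI[of _ "e / sqrt D"]) auto
  qed auto
  then show ?thesis by (simp add: ip_topology_def)
qed

lemma evaluations: "evaluations_continuous H ip"
  unfolding evaluations_continuous_def
proof
  fix w :: complex assume w: "w \<in> \<bbbD>"
  obtain C where C: "\<forall>F\<in>X. (norm (F w))\<^sup>2 \<le> C * nsq F"
    using point_eval_bound[OF w] by (elim exE)
  show "continuous_map (ip_topology H ip) euclidean (\<lambda>F. F w)"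
    by (rule functional_continuous[OF _ C[rule_format, OF H_X]]) simp_all
qed

lemma shift_cont: "shift_continuous H ip"
proof -
  obtain C where C: "\<forall>F\<in>X. shift F \<in> X \<and> nsq (shift F) \<le> C * nsq F"
    using shift_bound by (elim exE)
  define D where "D = max C 1"
  have D: "D > 0" by (simp add: D_def)
  have "continuous_map mtopology mtopology shift"
    unfolding metric_continuous_map[OF Metric_space_axioms]
  proof (intro conjI ballI allI impI)
    show "shift ` H \<subseteq> H" using H_shift by auto
    fix F and e :: real assume F: "F \<in> H" and e: "e > 0"
    have "ip_dist H ip (shift F) (shift G) < e" if G: "G \<in> H" "ip_dist H ip F G < e / sqrt D" for G
    proof -
      have "nsq (\<lambda>z. F z - G z) < (e / sqrt D)\<^sup>2"
        using G F e D by (simp add: ip_dist_less_iff)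
      then have "D * nsq (\<lambda>z. F z - G z) < e\<^sup>2"
        using D by (simp add: power_divide field_simps)
      moreover have "C * nsq (\<lambda>z. F z - G z) \<le> D * nsq (\<lambda>z. F z - G z)"
        by (rule mult_right_mono) (auto simp: D_def energy_nonneg)
      moreover have "shift (\<lambda>z. F z - G z) = (\<lambda>z. shift F z - shift G z)"
        by (auto simp: shift_def algebra_simps)
      ultimately have "nsq (\<lambda>z. shift F z - shift G z) < e\<^sup>2"
        using C[rule_format, OF X_diff(1)[OF H_X[OF F] H_X[OF G(1)]]] by simp
      then show ?thesis
        using F G e by (simp add: ip_dist_less_iff H_shift)
    qed
    then show "\<exists>\<delta>>0. \<forall>G. G \<in> H \<and> ip_dist H ip F G < \<delta> \<longrightarrow> ip_dist H ip (shift F) (shift G) < e"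
      using e D by (intro exI[of _ "e / sqrt D"]) auto
  qed
  then show ?thesis
    using H_shift by (auto simp: shift_continuous_def ip_topology_def)
qed

text \<open>The functional is given on all of \<open>X\<close> and then restricted to
  \<open>H\<close>, so its construction involves no polynomial approximation.\<close>

lemma Omega_maxI:
  assumes "\<And>F G. F \<in> X \<Longrightarrow> G \<in> X \<Longrightarrow> L (\<lambda>z. F z + G z) = L F + L G"
    and "\<And>c F. F \<in> X \<Longrightarrow> L (\<lambda>z. c * F z) = c * L F"
    and "\<And>F. F \<in> X \<Longrightarrow> (norm (L F))\<^sup>2 \<le> C * nsq F"
    and "\<And>p. L (disc_poly p) = poly p w"
  shows "w \<in> Omega_max H ip"
proof -
  have "L (\<lambda>z. F z - G z) = L F - L G" if "F \<in> X" "G \<in> X" for F G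
    using assms(1)[OF that(1) X_scale[OF that(2), of "-1"]] assms(2)[OF that(2), of "-1"] by simp
  then have "continuous_map (ip_topology H ip) euclidean L"
    using assms(3) H_X by (intro functional_continuous) auto
  then show ?thesis
    unfolding Omega_max_def linear_functional_on_def using assms H_X by (auto intro!: exI[of _ L])
qed

text \<open>Continuity at 0 gives a ball on which \<open>L\<close> is bounded by 1, and homogeneity
  turns this into a quadratic bound, the form in which membership is later refuted.\<close>

lemma Omega_maxD:
  assumes "w \<in> Omega_max H ip"
  shows "\<exists>C. \<forall>p. (norm (poly p w))\<^sup>2 \<le> C * nsq (disc_poly p)"
proof -
  obtain L where scale: "\<And>c F. F \<in> H \<Longrightarrow> L (\<lambda>z. c * F z) = c * L F"
    and cont: "continuous_map mtopology Met_TC.mtopology L" and L: "\<And>p. L (disc_poly p) = poly p w"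
    using assms unfolding Omega_max_def linear_functional_on_def ip_topology_def mtopology_is_euclidean
    by blast
  have "L (\<lambda>z. 0) = 0" using scale[OF zero_H, of 0] by simp
  then obtain d where d: "d > 0" "\<And>F. F \<in> H \<Longrightarrow> ip_dist H ip (\<lambda>z. 0) F < d \<Longrightarrow> norm (L F) < 1"
    using cont unfolding metric_continuous_map[OF Met_TC.Metric_space_axioms]
    by (auto dest!: bspec[OF _ zero_H] spec[of _ "1 :: real"])
  have small: "norm (L F) < 1" if "F \<in> H" "nsq F < d\<^sup>2" for F
  proof (rule d(2)[OF that(1)])
    have "nsq (\<lambda>z. 0 - F z) = nsq F"
      using nsq_scale[OF X_Hol[OF H_X[OF that(1)]], of "-1"] by simp
    then show "ip_dist H ip (\<lambda>z. 0) F < d"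
      using that d(1) by (subst ip_dist_less_iff) (auto simp: zero_H)
  qed
  have "(norm (poly p w))\<^sup>2 \<le> (4 / d\<^sup>2) * nsq (disc_poly p)" for p
  proof (cases "nsq (disc_poly p) = 0")
    case True
    then have "L (disc_poly p) = 0"
      using nsq_eq_0[OF poly_mem] \<open>L (\<lambda>z. 0) = 0\<close> by simp
    then show ?thesis using True L by simp
  next
    case False
    define s where "s = sqrt (nsq (disc_poly p))"
    have s: "s > 0" "s\<^sup>2 = nsq (disc_poly p)"
      using False energy_nonneg[of I l "disc_poly p"] by (auto simp: s_def)
    \<comment> \<open>Rescaling brings the energy to \<open>d\<^sup>2 / 4\<close>, inside the ball;
      this is the source of the constant \<open>4 / d\<^sup>2\<close>.\<close>
    define c where "c = d / (2 * s)"
    have c: "c > 0" using s d by (simp add: c_def)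
    have "nsq (\<lambda>z. of_real c * disc_poly p z) = c\<^sup>2 * s\<^sup>2"
      using s by (simp add: nsq_scale disc_poly_Hol_disc)
    also have "\<dots> = d\<^sup>2 / 4" using s(1) by (simp add: c_def power_divide power_mult_distrib)
    also have "\<dots> < d\<^sup>2" using d by simp
    finally have "norm (L (\<lambda>z. of_real c * disc_poly p z)) < 1"
      by (rule small[OF H_scale[OF poly_H]])
    then have "c * norm (poly p w) < 1"
      using c by (simp add: scale[OF poly_H] L norm_mult)
    then have "(c * norm (poly p w))\<^sup>2 \<le> 1\<^sup>2"
      using c by (intro power_mono) auto
    then show ?thesis
      unfolding s(2)[symmetric] using s(1) d(1)
      by (simp add: c_def power_mult_distrib power_divide field_simps)
  qed
  then show ?thesis by blast
qed

lemma disc_subset_Omega_max: "\<bbbD> \<subseteq> Omega_max H ip"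
proof
  fix w :: complex assume w: "w \<in> \<bbbD>"
  obtain C where C: "\<forall>F\<in>X. (norm (F w))\<^sup>2 \<le> C * nsq F"
    using point_eval_bound[OF w] by (elim exE)
  show "w \<in> Omega_max H ip"
    by (rule Omega_maxI[of "\<lambda>F. F w", OF _ _ C[rule_format]]) (use w in \<open>auto simp: disc_poly_def\<close>)
qed

end

section \<open>Hardy norm and weighted pairs of points\<close>

definition taylor :: "nat \<Rightarrow> (complex \<Rightarrow> complex) \<Rightarrow> complex"
  where "taylor k F = (deriv ^^ k) F 0 / fact k"

lemma taylor_sums:
  assumes "F \<in> Hol_disc" "z \<in> \<bbbD>"
  shows "(\<lambda>k. taylor k F * z ^ k) sums F z"
  using holomorphic_power_series[of F 0 1 z] assms by (simp add: Hol_disc_def taylor_def)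

lemma taylor_add:
  assumes "F \<in> Hol_disc" "G \<in> Hol_disc"
  shows "taylor k (\<lambda>z. F z + G z) = taylor k F + taylor k G"
  using assms higher_deriv_add[of F \<bbbD> G 0 k] by (simp add: Hol_disc_def taylor_def add_divide_distrib)

lemma taylor_scale:
  assumes "F \<in> Hol_disc"
  shows "taylor k (\<lambda>z. c * F z) = c * taylor k F"
  using assms higher_deriv_cmult[of F \<bbbD> 0 k c] by (simp add: Hol_disc_def taylor_def)

lemma has_fps_expansion_imp_taylor: "F has_fps_expansion f \<Longrightarrow> taylor k F = fps_nth f k"
  by (simp add: taylor_def fps_nth_fps_expansion)

text \<open>The shift multiplies the power series at 0 by \<open>fps_X\<close>.\<close>

lemma taylor_shift:
  assumes "F \<in> Hol_disc"
  shows "taylor k (shift F) = (if k = 0 then 0 else taylor (k - 1) F)"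
proof -
  have F: "F has_fps_expansion fps_expansion F 0"
    using assms by (intro has_fps_expansion_fps_expansion[of \<bbbD>]) (auto simp: Hol_disc_def)
  then have "shift F has_fps_expansion fps_X * fps_expansion F 0"
    unfolding shift_def by (intro has_fps_expansion_mult has_fps_expansion_fps_X)
  then show ?thesis
    by (simp add: has_fps_expansion_imp_taylor has_fps_expansion_imp_taylor[OF F])
qed

lemma taylor_disc_poly: "taylor k (disc_poly p) = coeff p k"
proof -
  have "\<forall>\<^sub>F z in nhds 0. z \<in> \<bbbD>"
    by (rule eventually_nhds_in_open) auto
  then have "disc_poly p has_fps_expansion fps_of_poly p"
    unfolding has_fps_expansion_def by (auto simp: disc_poly_def elim!: eventually_mono)
  then show ?thesis by (simp add: has_fps_expansion_imp_taylor)
qed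

text \<open>All coefficients are taken at 0, so the Weierstrass theorem on one smaller disc is
  enough.\<close>

lemma taylor_tendsto:
  assumes "\<And>n. f n \<in> Hol_disc"
    and "\<And>r. r < 1 \<Longrightarrow> uniform_limit (cball 0 r) f F sequentially"
  shows "(\<lambda>n. taylor k (f n)) \<longlonglongrightarrow> taylor k F"
  unfolding taylor_def
proof (intro tendsto_divide tendsto_const)
  show "(\<lambda>n. (deriv ^^ k) (f n) 0) \<longlonglongrightarrow> (deriv ^^ k) F 0"
  proof (rule higher_deriv_complex_uniform_limit)
    show "uniform_limit (ball 0 (1/2)) f F sequentially"
      by (rule uniform_limit_on_subset[OF assms(2)[of "1/2"]]) auto
    show "\<forall>\<^sub>F n in sequentially. f n holomorphic_on ball 0 (1/2)"
    proof (rule always_eventually, rule allI)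
      fix n
      have "f n holomorphic_on \<bbbD>" using assms(1)[of n] by (simp add: Hol_disc_def)
      then show "f n holomorphic_on ball 0 (1/2)" by (rule holomorphic_on_subset) auto
    qed
  qed auto
qed auto

section \<open>Growth and Lipschitz estimates in the Hardy space\<close>

lemma sum_power2_geometric_le:
  fixes t :: real
  assumes "0 \<le> t" "t < 1"
  shows "(\<Sum>k<n. (t ^ k)\<^sup>2) \<le> 1 / (1 - t)"
proof -
  have "(\<Sum>k<n. (t ^ k)\<^sup>2) \<le> (\<Sum>k<n. t ^ k)"
    using assms by (intro sum_mono) (simp add: power2_eq_square power_le_one mult_left_le)
  also have "\<dots> = (1 - t ^ n) / (1 - t)"
    using assms by (simp add: sum_gp_strict)
  also have "\<dots> \<le> 1 / (1 - t)"
    using assms by (intro divide_right_mono) auto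
  finally show ?thesis .
qed

text \<open>Cauchy-Schwarz on the partial sums of the power series. Since \<open>E\<close> need only
  bound the coefficient sums, any energy dominating the Hardy norm can be inserted.\<close>

lemma hardy_growth:
  assumes F: "F \<in> Hol_disc" and E: "\<And>n. (\<Sum>k<n. (norm (taylor k F))\<^sup>2) \<le> E"
    and z: "norm z \<le> r" "r < 1"
  shows "(norm (F z))\<^sup>2 \<le> E / (1 - r)"
proof (rule LIMSEQ_le_const2)
  have r: "0 \<le> r" using z norm_ge_zero order_trans by blast
  have "(\<lambda>n. \<Sum>k<n. taylor k F * z ^ k) \<longlonglongrightarrow> F z"
    using taylor_sums[OF F, of z] z by (simp add: sums_def)
  then show "(\<lambda>n. (norm (\<Sum>k<n. taylor k F * z ^ k))\<^sup>2) \<longlonglongrightarrow> (norm (F z))\<^sup>2"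
    by (intro tendsto_intros)
  have "(norm (\<Sum>k<n. taylor k F * z ^ k))\<^sup>2 \<le> E / (1 - r)" for n
  proof -
    have "norm (\<Sum>k<n. taylor k F * z ^ k) \<le> (\<Sum>k<n. norm (taylor k F) * r ^ k)"
      using z by (intro sum_norm_le) (simp add: norm_mult norm_power mult_left_mono power_mono)
    then have "(norm (\<Sum>k<n. taylor k F * z ^ k))\<^sup>2 \<le> (\<Sum>k<n. norm (taylor k F) * r ^ k)\<^sup>2"
      by (intro power_mono) auto
    also have "\<dots> \<le> (\<Sum>k<n. (norm (taylor k F))\<^sup>2) * (\<Sum>k<n. (r ^ k)\<^sup>2)"
      by (rule Cauchy_Schwarz_ineq_sum)
    also have "\<dots> \<le> E * (1 / (1 - r))"
      using E[of 0] r z by (intro mult_mono E sum_power2_geometric_le sum_nonneg) auto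
    finally show ?thesis by simp
  qed
  then show "\<exists>N. \<forall>n\<ge>N. (norm (\<Sum>k<n. taylor k F * z ^ k))\<^sup>2 \<le> E / (1 - r)" by blast
qed

text \<open>Keeping the factor \<open>R ^ k\<close> makes the bound summable over \<open>k\<close>
  when \<open>R < 1\<close>, unlike the Lipschitz constants on the closed disc.\<close>

lemma norm_power_diff_le:
  fixes x y :: complex
  assumes "norm x \<le> R" "norm y \<le> R"
  shows "norm (x ^ Suc k - y ^ Suc k) \<le> real (Suc k) * R ^ k * norm (x - y)"
proof (induction k)
  case (Suc k)
  have R: "0 \<le> R" using assms(1) norm_ge_zero order_trans by blast
  have "x ^ Suc (Suc k) - y ^ Suc (Suc k) = x * (x ^ Suc k - y ^ Suc k) + (x - y) * y ^ Suc k"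
    by (simp add: algebra_simps)
  also have "norm \<dots> \<le> norm x * norm (x ^ Suc k - y ^ Suc k) + norm (x - y) * norm y ^ Suc k"
    by (metis norm_mult norm_power norm_triangle_ineq)
  also have "\<dots> \<le> R * (real (Suc k) * R ^ k * norm (x - y)) + norm (x - y) * R ^ Suc k"
    using assms R Suc by (intro add_mono mult_mono power_mono) auto
  also have "\<dots> = real (Suc (Suc k)) * R ^ Suc k * norm (x - y)"
    by (simp add: algebra_simps)
  finally show ?case .
qed auto

lemma Suc_power_le_geometric:
  fixes t :: real
  assumes "0 \<le> t" "t < 1"
  shows "real (Suc k) * t ^ k \<le> 1 / (1 - t)"
proof -
  have "real (Suc k) * t ^ k = (\<Sum>j<Suc k. t ^ k)" by simp
  also have "\<dots> \<le> (\<Sum>j<Suc k. t ^ j)"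
    using assms by (intro sum_mono power_decreasing) auto
  also have "\<dots> = (1 - t ^ Suc k) / (1 - t)"
    using assms by (subst sum_gp_strict) auto
  also have "\<dots> \<le> 1 / (1 - t)"
    using assms by (intro divide_right_mono) (auto simp del: power_Suc)
  finally show ?thesis .
qed

text \<open>Writing the radius as \<open>t\<^sup>2\<close> provides two factors
  \<open>t ^ k\<close>: one absorbs the derivative factor \<open>Suc k\<close> at cost
  \<open>1 / (1 - t)\<close>, the other enters Cauchy-Schwarz. The first cost is squared and the
  second adds one more factor, hence the exponent 3.\<close>

lemma hardy_lipschitz:
  assumes F: "F \<in> Hol_disc" and E: "\<And>n. (\<Sum>k<n. (norm (taylor k F))\<^sup>2) \<le> E"
    and t: "0 \<le> t" "t < 1" and x: "norm x \<le> t\<^sup>2" and y: "norm y \<le> t\<^sup>2"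
  shows "(norm (F x - F y))\<^sup>2 \<le> (norm (x - y))\<^sup>2 * (E / (1 - t) ^ 3)"
proof (rule LIMSEQ_le_const2)
  have t2: "t\<^sup>2 < 1" using t by (simp add: power_less_one_iff)
  define s where "s n z = (\<Sum>k<n. taylor k F * z ^ k)" for n z
  have "(\<lambda>n. s n x) \<longlonglongrightarrow> F x" "(\<lambda>n. s n y) \<longlonglongrightarrow> F y"
    using taylor_sums[OF F, of x] taylor_sums[OF F, of y] x y t2 by (simp_all add: sums_def s_def)
  then show "(\<lambda>n. (norm (s (Suc n) x - s (Suc n) y))\<^sup>2) \<longlonglongrightarrow> (norm (F x - F y))\<^sup>2"
    by (intro tendsto_intros LIMSEQ_Suc)
  have "(norm (s (Suc n) x - s (Suc n) y))\<^sup>2 \<le> (norm (x - y))\<^sup>2 * (E / (1 - t) ^ 3)" for n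
  proof -
    define D where "D = norm (x - y) / (1 - t)"
    have D: "D \<ge> 0" using t by (simp add: D_def)
    \<comment> \<open>The constant terms cancel, which is why the partial sums run up to
      \<open>Suc n\<close>.\<close>
    have "s (Suc n) x - s (Suc n) y = (\<Sum>k<n. taylor (Suc k) F * (x ^ Suc k - y ^ Suc k))"
      unfolding s_def by (simp only: sum.lessThan_Suc_shift) (simp add: sum_subtractf[symmetric] algebra_simps)
    also have "norm \<dots> \<le> (\<Sum>k<n. norm (taylor (Suc k) F) * (t ^ k * D))"
    proof (rule sum_norm_le)
      fix k
      have "norm (x ^ Suc k - y ^ Suc k) \<le> real (Suc k) * (t\<^sup>2) ^ k * norm (x - y)"
        by (rule norm_power_diff_le[OF x y])
      also have "\<dots> = t ^ k * ((real (Suc k) * t ^ k) * norm (x - y))"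
        by (simp add: power2_eq_square power_mult_distrib)
      also have "\<dots> \<le> t ^ k * ((1 / (1 - t)) * norm (x - y))"
        using t by (intro mult_left_mono mult_right_mono Suc_power_le_geometric) auto
      finally show "norm (taylor (Suc k) F * (x ^ Suc k - y ^ Suc k)) \<le> norm (taylor (Suc k) F) * (t ^ k * D)"
        unfolding norm_mult by (intro mult_left_mono) (auto simp: D_def)
    qed
    also have "\<dots> = D * (\<Sum>k<n. norm (taylor (Suc k) F) * t ^ k)"
      by (simp add: sum_distrib_left mult_ac)
    finally have "(norm (s (Suc n) x - s (Suc n) y))\<^sup>2 \<le> (D * (\<Sum>k<n. norm (taylor (Suc k) F) * t ^ k))\<^sup>2"
      by (intro power_mono) auto
    also have "\<dots> = D\<^sup>2 * (\<Sum>k<n. norm (taylor (Suc k) F) * t ^ k)\<^sup>2"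
      by (simp add: power_mult_distrib)
    also have "\<dots> \<le> D\<^sup>2 * ((\<Sum>k<n. (norm (taylor (Suc k) F))\<^sup>2) * (\<Sum>k<n. (t ^ k)\<^sup>2))"
      by (intro mult_left_mono Cauchy_Schwarz_ineq_sum) auto
    also have "\<dots> \<le> D\<^sup>2 * (E * (1 / (1 - t)))"
    proof -
      have "(\<Sum>k<n. (norm (taylor (Suc k) F))\<^sup>2) \<le> E"
        using E[of "Suc n"] unfolding sum.lessThan_Suc_shift
        by (smt (verit) zero_le_power2)
      then show ?thesis
        using E[of 0] t by (intro mult_left_mono mult_mono sum_power2_geometric_le sum_nonneg) auto
    qed
    also have "\<dots> = (norm (x - y))\<^sup>2 * (E / (1 - t) ^ 3)"
      by (simp add: D_def power_divide power2_eq_square power3_eq_cube)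
    finally show ?thesis .
  qed
  then show "\<exists>N. \<forall>n\<ge>N. (norm (s (Suc n) x - s (Suc n) y))\<^sup>2 \<le> (norm (x - y))\<^sup>2 * (E / (1 - t) ^ 3)"
    by blast
qed

text \<open>The constant holds up to the boundary, so polynomials tolerate pairs of points that
  approach the circle.\<close>

lemma poly_lipschitz_closed_disc:
  fixes x y :: complex
  assumes "norm x \<le> 1" "norm y \<le> 1"
  shows "norm (poly p x - poly p y) \<le> (\<Sum>k\<le>degree p. norm (coeff p k) * real k) * norm (x - y)"
proof -
  have "poly p x - poly p y = (\<Sum>k\<le>degree p. coeff p k * (x ^ k - y ^ k))"
    by (simp add: poly_altdef sum_subtractf right_diff_distrib)
  also have "norm \<dots> \<le> (\<Sum>k\<le>degree p. norm (coeff p k) * (real k * norm (x - y)))"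
    using assms by (intro sum_norm_le) (simp add: norm_mult norm_power_diff mult_left_mono)
  finally show ?thesis by (simp add: sum_distrib_right mult.assoc)
qed

lemma poly_bound_closed_disc:
  fixes x :: complex
  assumes "norm x \<le> 1"
  shows "norm (poly p x) \<le> (\<Sum>k\<le>degree p. norm (coeff p k))"
  unfolding poly_altdef using assms
  by (intro sum_norm_le) (simp add: norm_mult norm_power power_le_one mult_left_le)

section \<open>Hardy norm plus weighted pair terms\<close>

text \<open>The square roots of \<open>c j\<close> become the weights after squaring. Increments and
  values get separate indices so that each functional is linear.\<close>

definition pair_functional ::
    "('j \<Rightarrow> real) \<Rightarrow> ('j \<Rightarrow> complex) \<Rightarrow> ('j \<Rightarrow> complex) \<Rightarrow> nat + 'j + 'j \<Rightarrow> (complex \<Rightarrow> complex) \<Rightarrow> complex"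
  where "pair_functional c x y i F = (case i of
      Inl k \<Rightarrow> taylor k F
    | Inr (Inl j) \<Rightarrow> of_real (sqrt (c j)) * (F (x j) - F (y j))
    | Inr (Inr j) \<Rightarrow> of_real (sqrt (c j)) * (x j - y j) * F (y j))"

definition pair_energy ::
    "('j \<Rightarrow> real) \<Rightarrow> ('j \<Rightarrow> complex) \<Rightarrow> ('j \<Rightarrow> complex) \<Rightarrow> (complex \<Rightarrow> complex) \<Rightarrow> 'j \<Rightarrow> real"
  where "pair_energy c x y F j =
    c j * ((norm (F (x j) - F (y j)))\<^sup>2 + (norm (x j - y j))\<^sup>2 * (norm (F (y j)))\<^sup>2)"

text \<open>\<open>weight_bound\<close> is what makes the pair terms of bounded Lipschitz functions
  summable, in particular those of polynomials.\<close>

locale pair_family =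
  fixes J :: "'j set" and c :: "'j \<Rightarrow> real" and x y :: "'j \<Rightarrow> complex" and \<sigma> :: real
  assumes c_nonneg: "\<And>j. j \<in> J \<Longrightarrow> 0 \<le> c j"
    and x_disc: "\<And>j. j \<in> J \<Longrightarrow> x j \<in> \<bbbD>"
    and y_disc: "\<And>j. j \<in> J \<Longrightarrow> y j \<in> \<bbbD>"
    and weight_bound: "\<And>T. finite T \<Longrightarrow> T \<subseteq> J \<Longrightarrow> (\<Sum>j\<in>T. c j * (norm (x j - y j))\<^sup>2) \<le> \<sigma>"
begin

abbreviation "index \<equiv> (UNIV <+> (J <+> J) :: (nat + 'j + 'j) set)"
abbreviation "functional \<equiv> pair_functional c x y"
abbreviation "q \<equiv> pair_energy c x y"
abbreviation "pair_space \<equiv> finite_energy index functional"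
abbreviation "pair_nsq \<equiv> energy index functional"

text \<open>Index sets of the shape \<open>{..<n} <+> (T <+> T)\<close> are cofinal among the finite
  ones, so the Taylor and pair terms can be estimated separately.\<close>

lemma sum_functional:
  assumes "finite T" "T \<subseteq> J"
  shows "(\<Sum>i\<in>{..<n} <+> (T <+> T). (norm (functional i F))\<^sup>2)
    = (\<Sum>k<n. (norm (taylor k F))\<^sup>2) + (\<Sum>j\<in>T. q F j)"
proof -
  have "(\<Sum>i\<in>{..<n} <+> (T <+> T). (norm (functional i F))\<^sup>2) = (\<Sum>k<n. (norm (taylor k F))\<^sup>2)
    + ((\<Sum>j\<in>T. (norm (functional (Inr (Inl j)) F))\<^sup>2) + (\<Sum>j\<in>T. (norm (functional (Inr (Inr j)) F))\<^sup>2))"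
    using assms by (simp add: sum.Plus o_def pair_functional_def)
  also have "(\<Sum>j\<in>T. (norm (functional (Inr (Inl j)) F))\<^sup>2) + (\<Sum>j\<in>T. (norm (functional (Inr (Inr j)) F))\<^sup>2)
    = (\<Sum>j\<in>T. q F j)"
    unfolding sum.distrib[symmetric] using assms c_nonneg
    by (intro sum.cong)
       (auto simp: pair_functional_def pair_energy_def norm_mult power_mult_distrib distrib_left subset_iff)
  finally show ?thesis .
qed

lemma pair_energyI:
  assumes F: "F \<in> Hol_disc"
    and A: "\<And>n. (\<Sum>k<n. (norm (taylor k F))\<^sup>2) \<le> A"
    and B: "\<And>T. finite T \<Longrightarrow> T \<subseteq> J \<Longrightarrow> (\<Sum>j\<in>T. q F j) \<le> B"
  shows "F \<in> pair_space" "pair_nsq F \<le> A + B"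
proof -
  have main: "(\<Sum>i\<in>S. (norm (functional i F))\<^sup>2) \<le> A + B" if S: "finite S" "S \<subseteq> index" for S
  proof -
    \<comment> \<open>\<open>T\<close> collects every \<open>j\<close> occurring in either copy,
      which enlarges \<open>S\<close> to a set of the shape in
      \<open>sum_functional\<close>.\<close>
    define T where "T = ((\<lambda>j. Inr (Inl j)) -` S \<union> (\<lambda>j. Inr (Inr j)) -` S :: 'j set)"
    have T: "finite T" "T \<subseteq> J"
      unfolding T_def using S by (auto intro!: finite_vimageI injI)
    have "finite (Inl -` S :: nat set)"
      using S(1) by (intro finite_vimageI) auto
    then obtain n where n: "Inl -` S \<subseteq> {..<n}"
      using finite_nat_iff_bounded by blast
    have "S \<subseteq> {..<n} <+> (T <+> T)"
    proof
      fix i assume "i \<in> S"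
      then show "i \<in> {..<n} <+> (T <+> T)"
        using n by (cases i rule: sum.exhaust; (rename_tac k, case_tac k)?) (auto simp: T_def)
    qed
    then have "(\<Sum>i\<in>S. (norm (functional i F))\<^sup>2) \<le> (\<Sum>i\<in>{..<n} <+> (T <+> T). (norm (functional i F))\<^sup>2)"
      using T by (intro sum_mono2) (auto intro!: finite_Plus)
    also have "\<dots> \<le> A + B"
      unfolding sum_functional[OF T] by (intro add_mono A B T)
    finally show ?thesis .
  qed
  show "F \<in> pair_space"
    by (rule finite_energyI(1)[OF F, where B = "A + B"]) (rule main)
  show "pair_nsq F \<le> A + B"
    by (rule finite_energyI(2)[OF F]) (rule main)
qed

lemma taylor_le_pair_nsq: "F \<in> pair_space \<Longrightarrow> (\<Sum>k<n. (norm (taylor k F))\<^sup>2) \<le> pair_nsq F"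
  using finite_sum_le_energy[of F index functional "{..<n} <+> ({} <+> {})"]
  by (simp only: sum_functional[of "{}"] finite.emptyI empty_subsetI) (auto intro!: finite_Plus)

lemma q_le_pair_nsq: "F \<in> pair_space \<Longrightarrow> finite T \<Longrightarrow> T \<subseteq> J \<Longrightarrow> (\<Sum>j\<in>T. q F j) \<le> pair_nsq F"
  using finite_sum_le_energy[of F index functional "{..<0} <+> (T <+> T)"]
  by (simp only: sum_functional) (auto intro!: finite_Plus)

lemma pair_space_Hol: "F \<in> pair_space \<Longrightarrow> F \<in> Hol_disc"
  by (simp add: finite_energy_def)

lemma q_le:
  assumes j: "j \<in> J" and "norm (F (x j) - F (y j)) \<le> \<Lambda> * norm (x j - y j)" "norm (F (y j)) \<le> M"
  shows "q F j \<le> (c j * (norm (x j - y j))\<^sup>2) * (\<Lambda>\<^sup>2 + M\<^sup>2)"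
proof -
  have "(norm (F (x j) - F (y j)))\<^sup>2 \<le> (\<Lambda> * norm (x j - y j))\<^sup>2" "(norm (F (y j)))\<^sup>2 \<le> M\<^sup>2"
    using assms by (auto intro!: power_mono)
  then have "q F j \<le> c j * ((\<Lambda> * norm (x j - y j))\<^sup>2 + (norm (x j - y j))\<^sup>2 * M\<^sup>2)"
    unfolding pair_energy_def by (intro mult_left_mono add_mono c_nonneg j) auto
  then show ?thesis by (simp add: power_mult_distrib algebra_simps)
qed

lemma disc_poly_pair_space:
  shows "disc_poly p \<in> pair_space"
    and "pair_nsq (disc_poly p) \<le> (\<Sum>k\<le>degree p. (norm (coeff p k))\<^sup>2)
      + \<sigma> * ((\<Sum>k\<le>degree p. norm (coeff p k) * real k)\<^sup>2 + (\<Sum>k\<le>degree p. norm (coeff p k))\<^sup>2)"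
proof -
  let ?\<Lambda> = "\<Sum>k\<le>degree p. norm (coeff p k) * real k" and ?M = "\<Sum>k\<le>degree p. norm (coeff p k)"
  have A: "(\<Sum>k<n. (norm (taylor k (disc_poly p)))\<^sup>2) \<le> (\<Sum>k\<le>degree p. (norm (coeff p k))\<^sup>2)" for n
  proof -
    have "(\<Sum>k<n. (norm (taylor k (disc_poly p)))\<^sup>2) = (\<Sum>k\<in>{..<n} \<inter> {..degree p}. (norm (coeff p k))\<^sup>2)"
      by (intro sum.mono_neutral_cong_right) (auto simp: taylor_disc_poly coeff_eq_0 not_le)
    also have "\<dots> \<le> (\<Sum>k\<le>degree p. (norm (coeff p k))\<^sup>2)"
      by (intro sum_mono2) auto
    finally show ?thesis .
  qed
  have B: "(\<Sum>j\<in>T. q (disc_poly p) j) \<le> \<sigma> * (?\<Lambda>\<^sup>2 + ?M\<^sup>2)" if T: "finite T" "T \<subseteq> J" for T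
  proof -
    have "(\<Sum>j\<in>T. q (disc_poly p) j) \<le> (\<Sum>j\<in>T. (c j * (norm (x j - y j))\<^sup>2) * (?\<Lambda>\<^sup>2 + ?M\<^sup>2))"
    proof (intro sum_mono q_le)
      fix j assume "j \<in> T"
      then have j: "j \<in> J" using T by auto
      then show "j \<in> J" .
      have xy: "norm (x j) < 1" "norm (y j) < 1" using x_disc[OF j] y_disc[OF j] by auto
      show "norm (disc_poly p (x j) - disc_poly p (y j)) \<le> ?\<Lambda> * norm (x j - y j)"
        using xy poly_lipschitz_closed_disc[of "x j" "y j" p] by (simp add: disc_poly_def)
      show "norm (disc_poly p (y j)) \<le> ?M"
        using xy poly_bound_closed_disc[of "y j" p] by (simp add: disc_poly_def)
    qed
    also have "\<dots> = (\<Sum>j\<in>T. c j * (norm (x j - y j))\<^sup>2) * (?\<Lambda>\<^sup>2 + ?M\<^sup>2)"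
      by (simp only: sum_distrib_right)
    also have "\<dots> \<le> \<sigma> * (?\<Lambda>\<^sup>2 + ?M\<^sup>2)"
      by (intro mult_right_mono weight_bound T) auto
    finally show ?thesis .
  qed
  show "disc_poly p \<in> pair_space" "pair_nsq (disc_poly p) \<le> (\<Sum>k\<le>degree p. (norm (coeff p k))\<^sup>2)
      + \<sigma> * (?\<Lambda>\<^sup>2 + ?M\<^sup>2)"
    by (rule pair_energyI[OF disc_poly_Hol_disc A]; rule B; assumption)+
qed

text \<open>The shift preserves the Hardy part. By the product rule the increment contributes at
  most \<open>2 * u\<^sup>2 + 2 * v\<^sup>2\<close> and the value term another
  \<open>v\<^sup>2\<close>, hence a factor 3 on the pair terms and 4 in total.\<close>

lemma shift_pair_space:
  assumes F: "F \<in> pair_space"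
  shows "shift F \<in> pair_space" "pair_nsq (shift F) \<le> 4 * pair_nsq F"
proof -
  note FH = pair_space_Hol[OF F]
  have A: "(\<Sum>k<n. (norm (taylor k (shift F)))\<^sup>2) \<le> pair_nsq F" for n
  proof (cases n)
    case 0
    then show ?thesis by (simp add: energy_nonneg)
  next
    case (Suc m)
    have "(\<Sum>k<n. (norm (taylor k (shift F)))\<^sup>2) = (\<Sum>k<m. (norm (taylor k F))\<^sup>2)"
      unfolding Suc sum.lessThan_Suc_shift by (simp add: taylor_shift[OF FH])
    then show ?thesis using taylor_le_pair_nsq[OF F, of m] by simp
  qed
  have B: "(\<Sum>j\<in>T. q (shift F) j) \<le> 3 * pair_nsq F" if T: "finite T" "T \<subseteq> J" for T
  proof -
    have "q (shift F) j \<le> 3 * q F j" if "j \<in> T" for j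
    proof -
      have j: "j \<in> J" using that T by auto
      have n: "norm (x j) \<le> 1" "norm (y j) \<le> 1"
        using x_disc[OF j] y_disc[OF j] by auto
      define u v where "u = norm (F (x j) - F (y j))" and "v = norm (x j - y j) * norm (F (y j))"
      have "shift F (x j) - shift F (y j) = x j * (F (x j) - F (y j)) + (x j - y j) * F (y j)"
        by (simp add: shift_def algebra_simps)
      then have "norm (shift F (x j) - shift F (y j)) \<le> norm (x j) * u + v"
        unfolding u_def v_def norm_mult[symmetric] by (simp add: norm_triangle_ineq)
      also have "\<dots> \<le> u + v"
        using n by (simp add: u_def mult_left_le_one_le)
      finally have "(norm (shift F (x j) - shift F (y j)))\<^sup>2 \<le> (u + v)\<^sup>2"
        by (intro power_mono) auto
      also have "\<dots> \<le> 2 * u\<^sup>2 + 2 * v\<^sup>2"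
        using zero_le_power2[of "u - v"] by (simp add: power2_eq_square algebra_simps)
      finally have 1: "(norm (shift F (x j) - shift F (y j)))\<^sup>2 \<le> 2 * u\<^sup>2 + 2 * v\<^sup>2" .
      have "norm (shift F (y j)) \<le> norm (F (y j))"
        using n by (simp add: shift_def norm_mult mult_left_le_one_le)
      then have 2: "(norm (x j - y j))\<^sup>2 * (norm (shift F (y j)))\<^sup>2 \<le> v\<^sup>2"
        unfolding v_def power_mult_distrib by (intro mult_left_mono power_mono) auto
      have "q (shift F) j \<le> c j * (3 * (u\<^sup>2 + v\<^sup>2))"
        unfolding pair_energy_def using 1 2 by (intro mult_left_mono c_nonneg j) (smt (verit) zero_le_power2)
      also have "\<dots> = 3 * q F j"
        by (simp add: pair_energy_def u_def v_def power_mult_distrib)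
      finally show ?thesis .
    qed
    then have "(\<Sum>j\<in>T. q (shift F) j) \<le> (\<Sum>j\<in>T. 3 * q F j)"
      by (rule sum_mono)
    also have "\<dots> \<le> 3 * pair_nsq F"
      using q_le_pair_nsq[OF F T] by (simp flip: sum_distrib_left)
    finally show ?thesis .
  qed
  show "shift F \<in> pair_space"
    by (rule pair_energyI(1)[OF shift_Hol_disc[OF FH] A]) (rule B)
  have "pair_nsq (shift F) \<le> pair_nsq F + 3 * pair_nsq F"
    by (rule pair_energyI(2)[OF shift_Hol_disc[OF FH] A]) (rule B)
  then show "pair_nsq (shift F) \<le> 4 * pair_nsq F" by simp
qed

sublocale energy_space index functional
proof
  fix i F G assume i: "i \<in> index" and FG: "F \<in> Hol_disc" "G \<in> Hol_disc"
  show "functional i (\<lambda>z. F z + G z) = functional i F + functional i G"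
    using FG by (auto simp: pair_functional_def taylor_add algebra_simps split: sum.split)
next
  fix i c' F assume i: "i \<in> index" and F: "F \<in> Hol_disc"
  show "functional i (\<lambda>z. c' * F z) = c' * functional i F"
    using F by (auto simp: pair_functional_def taylor_scale algebra_simps split: sum.split)
next
  fix i and f :: "nat \<Rightarrow> complex \<Rightarrow> complex" and F
  assume i: "i \<in> index" and f: "\<And>n. f n \<in> Hol_disc" and F: "F \<in> Hol_disc"
    and lim: "\<And>r. r < 1 \<Longrightarrow> uniform_limit (cball 0 r) f F sequentially"
  have pt: "(\<lambda>n. f n z) \<longlonglongrightarrow> F z" if "z \<in> \<bbbD>" for z
    by (rule tendsto_uniform_limitI[OF lim[of "norm z"]]) (use that in auto)
  show "(\<lambda>n. functional i (f n)) \<longlonglongrightarrow> functional i F"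
  proof (cases i)
    case (Inl k)
    then show ?thesis by (simp add: pair_functional_def taylor_tendsto[OF f lim])
  next
    case (Inr i')
    then obtain j where "j \<in> J" "i = Inr (Inl j) \<or> i = Inr (Inr j)"
      using i by auto
    then show ?thesis
      by (auto simp: pair_functional_def intro!: tendsto_intros pt x_disc y_disc)
  qed
next
  fix r :: real assume r: "r < 1"
  show "\<exists>C. \<forall>F\<in>pair_space. \<forall>z\<in>cball 0 r. (norm (F z))\<^sup>2 \<le> C * pair_nsq F"
  proof (intro exI ballI)
    fix F and z :: complex assume F: "F \<in> pair_space" and z: "z \<in> cball 0 r"
    show "(norm (F z))\<^sup>2 \<le> (1 / (1 - r)) * pair_nsq F"
      using hardy_growth[OF pair_space_Hol[OF F] taylor_le_pair_nsq[OF F], of z r] r z by simp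
  qed
next
  show "disc_poly p \<in> pair_space" for p by (rule disc_poly_pair_space)
next
  show "\<exists>C. \<forall>F\<in>pair_space. shift F \<in> pair_space \<and> pair_nsq (shift F) \<le> C * pair_nsq F"
    using shift_pair_space by (intro exI ballI conjI)
qed

text \<open>The monomial of degree \<open>k\<close> has energy at most of order
  \<open>k\<^sup>2\<close>, while \<open>((norm w)\<^sup>2) ^ k\<close> would grow exponentially
  outside the closed disc.\<close>

lemma Omega_max_subset_cball: "Omega_max H ip \<subseteq> cball 0 1"
proof
  fix w assume "w \<in> Omega_max H ip"
  then obtain C where C: "\<And>p. (norm (poly p w))\<^sup>2 \<le> C * pair_nsq (disc_poly p)"
    using Omega_maxD by blast
  define D where "D = max C 0"
  show "w \<in> cball 0 1"
  proof (rule ccontr)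
    assume "w \<notin> cball 0 1"
    then have w: "norm w > 1" by simp
    have main: "((norm w)\<^sup>2) ^ k \<le> D * (1 + \<sigma> * ((real k)\<^sup>2 + 1))" for k
    proof -
      have "(norm (poly (monom 1 k) w))\<^sup>2 \<le> C * pair_nsq (disc_poly (monom 1 k))" by (rule C)
      also have "\<dots> \<le> D * pair_nsq (disc_poly (monom 1 k))"
        by (intro mult_right_mono energy_nonneg) (auto simp: D_def)
      also have "\<dots> \<le> D * (1 + \<sigma> * ((real k)\<^sup>2 + 1))"
      proof (rule mult_left_mono)
        have s: "(\<Sum>i\<le>k. f (coeff (monom 1 k :: complex poly) i) i) = f 1 k"
          if "\<And>i. f 0 i = 0" for f :: "complex \<Rightarrow> nat \<Rightarrow> real"
        proof -
          have "(\<Sum>i\<le>k. f (coeff (monom 1 k :: complex poly) i) i) = (\<Sum>i\<le>k. if i = k then f 1 k else 0)"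
            using that by (intro sum.cong) auto
          then show ?thesis by simp
        qed
        have "(\<Sum>i\<le>k. (norm (coeff (monom 1 k :: complex poly) i))\<^sup>2) = 1"
          "(\<Sum>i\<le>k. norm (coeff (monom 1 k :: complex poly) i) * real i) = real k"
          "(\<Sum>i\<le>k. norm (coeff (monom 1 k :: complex poly) i)) = 1"
          using s[of "\<lambda>a i. (norm a)\<^sup>2"] s[of "\<lambda>a i. norm a * real i"] s[of "\<lambda>a i. norm a"] by simp_all
        then show "pair_nsq (disc_poly (monom 1 k)) \<le> 1 + \<sigma> * ((real k)\<^sup>2 + 1)"
          using disc_poly_pair_space(2)[of "monom 1 k"] by (simp add: degree_monom_eq)
      qed (simp add: D_def)
      finally show ?thesis
        by (simp add: poly_monom norm_power power_mult[symmetric] mult.commute)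
    qed
    define u where "u = 1 / norm w"
    have le: "1 \<le> D * (1 + \<sigma>) * (u ^ k)\<^sup>2 + D * \<sigma> * (real k * u ^ k)\<^sup>2" for k
    proof -
      have "1 = ((norm w)\<^sup>2) ^ k * (u ^ k)\<^sup>2"
        using w by (auto simp: u_def power_divide power_mult[symmetric] mult.commute)
      also have "\<dots> \<le> D * (1 + \<sigma> * ((real k)\<^sup>2 + 1)) * (u ^ k)\<^sup>2"
        by (intro mult_right_mono main) auto
      also have "\<dots> = D * (1 + \<sigma>) * (u ^ k)\<^sup>2 + D * \<sigma> * (real k * u ^ k)\<^sup>2"
        by (simp add: power_mult_distrib algebra_simps)
      finally show ?thesis .
    qed
    have u: "norm u < 1" using w by (simp add: u_def divide_less_eq)
    have "(\<lambda>k. D * (1 + \<sigma>) * (u ^ k)\<^sup>2 + D * \<sigma> * (real k * u ^ k)\<^sup>2)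
        \<longlonglongrightarrow> D * (1 + \<sigma>) * 0\<^sup>2 + D * \<sigma> * 0\<^sup>2"
      using u by (intro tendsto_intros LIMSEQ_power_zero powser_times_n_limit_0)
    then have "\<forall>\<^sub>F k in sequentially. D * (1 + \<sigma>) * (u ^ k)\<^sup>2 + D * \<sigma> * (real k * u ^ k)\<^sup>2 < 1"
      by (rule order_tendstoD) simp
    then show False
      using le by (auto simp: eventually_sequentially not_less[symmetric])
  qed
qed

end

section \<open>Nets on the circle and peaking polynomials\<close>

lemma norm_exp_i_diff_le:
  fixes a b :: real
  shows "norm (exp (\<i> * of_real a) - exp (\<i> * of_real b)) \<le> \<bar>a - b\<bar>"
proof -
  have "exp (\<i> * of_real a) - exp (\<i> * of_real b) = exp (\<i> * of_real b) * (exp (\<i> * of_real (a - b)) - 1)"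
    by (simp add: right_diff_distrib flip: exp_add)
  then have "norm (exp (\<i> * of_real a) - exp (\<i> * of_real b)) = 2 * \<bar>sin ((a - b) / 2)\<bar>"
    by (simp only: norm_mult norm_exp_i_times dist_exp_i_1 mult_1)
  then show ?thesis
    using abs_sin_x_le_abs_x[of "(a - b) / 2"] by simp
qed

text \<open>The circle is cut into \<open>M\<close> arcs by the argument, and one point of
  \<open>K\<close> is chosen in each arc meeting \<open>K\<close>. The net thus lies inside
  \<open>K\<close>, which later keeps it away from the points where evaluation must be unbounded.
  The 7 bounds \<open>2 * pi\<close>.\<close>

lemma circle_net:
  fixes K :: "complex set" and M :: nat
  assumes K: "K \<subseteq> \<bbbT>" and M: "M \<ge> 1"
  shows "\<exists>A. finite A \<and> A \<subseteq> K \<and> card A \<le> M \<and> (\<forall>w\<in>K. \<exists>\<zeta>\<in>A. norm (w - \<zeta>) \<le> 7 / M)"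
proof -
  define g where "g w = \<lfloor>M * Arg2pi w / (2 * pi)\<rfloor>" for w
  have g: "g w \<in> {0..<int M}" for w
  proof -
    have "0 \<le> M * Arg2pi w / (2 * pi)" "M * Arg2pi w / (2 * pi) < M"
      using Arg2pi[of w] M by (simp_all add: field_simps)
    then show ?thesis by (simp add: g_def floor_less_iff)
  qed
  define A where "A = inv_into K g ` g ` K"
  have sub: "g ` K \<subseteq> {0..<int M}" using g by auto
  then have fin: "finite (g ` K)" by (rule finite_subset) simp
  have "card A \<le> card (g ` K)" unfolding A_def by (rule card_image_le[OF fin])
  also have "\<dots> \<le> M" using card_mono[OF _ sub] by simp
  finally have "card A \<le> M" .
  moreover have "A \<subseteq> K" by (auto simp: A_def inv_into_into)
  moreover have "\<exists>\<zeta>\<in>A. norm (w - \<zeta>) \<le> 7 / M" if w: "w \<in> K" for w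
  proof
    define \<zeta> where "\<zeta> = inv_into K g (g w)"
    show "\<zeta> \<in> A" using w by (simp add: A_def \<zeta>_def)
    have \<zeta>: "\<zeta> \<in> K" "g \<zeta> = g w"
      using w by (auto simp: \<zeta>_def inv_into_into f_inv_into_f)
    have "\<bar>M * Arg2pi w / (2 * pi) - M * Arg2pi \<zeta> / (2 * pi)\<bar> < 1"
      using \<zeta>(2) unfolding g_def by linarith
    then have "\<bar>(Arg2pi w - Arg2pi \<zeta>) * (M / (2 * pi))\<bar> < 1"
      by (simp add: field_simps)
    then have "\<bar>Arg2pi w - Arg2pi \<zeta>\<bar> * (M / (2 * pi)) < 1"
      by (simp add: abs_mult)
    then have d: "\<bar>Arg2pi w - Arg2pi \<zeta>\<bar> < 2 * pi / M"
      using M by (simp add: field_simps)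
    have "w = exp (\<i> * of_real (Arg2pi w))" "\<zeta> = exp (\<i> * of_real (Arg2pi \<zeta>))"
      using w \<zeta>(1) K complex_norm_eq_1_exp by (metis mem_sphere_0 subsetD)+
    then have "norm (w - \<zeta>) \<le> \<bar>Arg2pi w - Arg2pi \<zeta>\<bar>"
      by (metis norm_exp_i_diff_le)
    also have "\<dots> \<le> 7 / M"
      using M pi_less_4 pi_approx by (intro less_imp_le order_less_le_trans[OF d] divide_right_mono) auto
    finally show "norm (w - \<zeta>) \<le> 7 / M" .
  qed
  ultimately show ?thesis using fin by (intro exI[of _ A]) (auto simp: A_def)
qed

section \<open>Polynomials peaking at a boundary point\<close>

definition mean_poly :: "nat \<Rightarrow> complex \<Rightarrow> complex poly"
  where "mean_poly N w = smult (1 / of_nat N) (\<Sum>k<N. monom (cnj w ^ k) k)"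

lemma poly_mean_poly: "poly (mean_poly N w) z = (\<Sum>k<N. (cnj w * z) ^ k) / of_nat N"
  by (simp add: mean_poly_def poly_sum poly_monom power_mult_distrib)

lemma coeff_mean_poly: "coeff (mean_poly N w) k = (if k < N then cnj w ^ k / of_nat N else 0)"
  by (simp add: mean_poly_def coeff_sum if_distrib[of "\<lambda>a. a / _"] cong: if_cong)

lemma mean_poly_self:
  assumes "norm w = 1" "N \<ge> 1"
  shows "poly (mean_poly N w) w = 1"
proof -
  have "cnj w * w = 1" using assms(1) complex_norm_square[of w] by (simp add: mult.commute)
  then show ?thesis using assms(2) by (simp add: poly_mean_poly)
qed

lemma mean_poly_bound:
  assumes "norm w = 1" "N \<ge> 1" "norm z \<le> 1"
  shows "norm (poly (mean_poly N w) z) \<le> 1"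
proof -
  have "norm (\<Sum>k<N. (cnj w * z) ^ k) \<le> (\<Sum>k<N. 1)"
    using assms by (intro sum_norm_le) (simp add: norm_power norm_mult power_le_one)
  then show ?thesis using assms by (simp add: poly_mean_poly norm_divide)
qed

lemma mean_poly_lipschitz:
  assumes "norm w = 1" "N \<ge> 1" "norm x \<le> 1" "norm y \<le> 1"
  shows "norm (poly (mean_poly N w) x - poly (mean_poly N w) y) \<le> N * norm (x - y)"
proof -
  have d: "norm (cnj w * x - cnj w * y) = norm (x - y)"
    using assms by (simp add: norm_mult flip: right_diff_distrib)
  have "norm (\<Sum>k<N. (cnj w * x) ^ k - (cnj w * y) ^ k) \<le> (\<Sum>k<N. N * norm (x - y))"
  proof (rule sum_norm_le)
    fix k assume "k \<in> {..<N}"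
    have "norm ((cnj w * x) ^ k - (cnj w * y) ^ k) \<le> k * norm (x - y)"
      unfolding d[symmetric] using assms by (intro norm_power_diff) (auto simp: norm_mult)
    also have "\<dots> \<le> N * norm (x - y)"
      using \<open>k \<in> {..<N}\<close> by (intro mult_right_mono) auto
    finally show "norm ((cnj w * x) ^ k - (cnj w * y) ^ k) \<le> N * norm (x - y)" .
  qed
  then have "norm ((\<Sum>k<N. (cnj w * x) ^ k - (cnj w * y) ^ k) / of_nat N) \<le> N * norm (x - y)"
    using assms(2) by (simp add: norm_divide field_simps)
  then show ?thesis
    by (simp add: poly_mean_poly sum_subtractf diff_divide_distrib)
qed

lemma norm_one_minus_cnj_mult:
  assumes "norm w = 1"
  shows "norm (1 - cnj w * z) = norm (z - w)"
proof -
  have "1 - cnj w * z = cnj w * (w - z)"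
    using assms complex_norm_square[of w] by (simp add: algebra_simps)
  then show ?thesis using assms by (simp add: norm_mult norm_minus_commute)
qed

lemma poly_mean_poly_eq:
  assumes "norm w = 1" "z \<noteq> w"
  shows "poly (mean_poly N w) z = (1 - (cnj w * z) ^ N) / (of_nat N * (1 - cnj w * z))"
proof -
  have "1 - cnj w * z \<noteq> 0"
    using norm_one_minus_cnj_mult[OF assms(1), of z] assms(2) by auto
  then show ?thesis by (simp add: poly_mean_poly sum_gp_strict mult.commute)
qed

lemma mean_poly_away_bound:
  assumes w: "norm w = 1" and N: "N \<ge> 1" and z: "norm z \<le> 1" and d: "0 < d" "d \<le> norm (z - w)"
  shows "norm (poly (mean_poly N w) z) \<le> 2 / (N * d)"
proof -
  have "norm (1 - (cnj w * z) ^ N) \<le> 2"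
    using norm_triangle_ineq4[of 1 "(cnj w * z) ^ N"] w z power_le_one[of "norm z" N]
    by (simp add: norm_power norm_mult)
  moreover have "z \<noteq> w" using d by auto
  ultimately show ?thesis
    unfolding poly_mean_poly_eq[OF w \<open>z \<noteq> w\<close>] norm_divide norm_mult[of "of_nat N"]
      norm_one_minus_cnj_mult[OF w] norm_of_nat
    using N d by (intro frac_le mult_left_mono) auto
qed

text \<open>The obvious Lipschitz constant is of order \<open>N\<close>. Over a common denominator
  the numerator is at most \<open>2 * N * norm (x - y)\<close>, and the \<open>N\<close> dividing
  the mean cancels it, so the constant does not depend on \<open>N\<close>.\<close>

lemma mean_poly_away_lipschitz:
  assumes w: "norm w = 1" and N: "N \<ge> 1" and x: "norm x \<le> 1" and y: "norm y \<le> 1"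
    and d: "0 < d" "d \<le> norm (x - w)" "d \<le> norm (y - w)"
  shows "norm (poly (mean_poly N w) x - poly (mean_poly N w) y) \<le> 2 / d\<^sup>2 * norm (x - y)"
proof -
  define u v where "u = cnj w * x" and "v = cnj w * y"
  have uv: "norm u \<le> 1" "norm v \<le> 1" "norm (u - v) = norm (x - y)"
    using w x y by (auto simp: u_def v_def norm_mult simp flip: right_diff_distrib)
  have du: "norm (1 - u) = norm (x - w)" "norm (1 - v) = norm (y - w)"
    using norm_one_minus_cnj_mult[OF w] by (auto simp: u_def v_def)
  have ne: "1 - u \<noteq> 0" "1 - v \<noteq> 0" using du d by auto
  obtain M where M: "N = Suc M" using N by (cases N) auto
  \<comment> \<open>The regrouping leaves differences of powers with exponents 1, \<open>N\<close>
    and \<open>M = N - 1\<close>, whose Lipschitz constants add up to \<open>2 * N\<close>.\<close>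
  have num: "(1 - u ^ N) * (1 - v) - (1 - v ^ N) * (1 - u)
      = (u - v) - (u ^ N - v ^ N) + u * v * (u ^ M - v ^ M)"
    by (simp add: M algebra_simps)
  have "norm ((1 - u ^ N) * (1 - v) - (1 - v ^ N) * (1 - u))
      \<le> norm (u - v) + norm (u ^ N - v ^ N) + norm (u * v * (u ^ M - v ^ M))"
    unfolding num
    by (rule order_trans[OF norm_triangle_ineq], rule add_right_mono, rule norm_triangle_ineq4)
  also have "\<dots> \<le> norm (u - v) + N * norm (u - v) + M * norm (u - v)"
  proof (intro add_mono)
    show "norm (u ^ N - v ^ N) \<le> N * norm (u - v)" by (rule norm_power_diff[OF uv(1,2)])
    have "norm (u * v * (u ^ M - v ^ M)) \<le> 1 * norm (u ^ M - v ^ M)"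
      unfolding norm_mult using uv by (intro mult_right_mono mult_le_one) auto
    also have "\<dots> \<le> M * norm (u - v)" using norm_power_diff[OF uv(1,2), of M] by simp
    finally show "norm (u * v * (u ^ M - v ^ M)) \<le> M * norm (u - v)" .
  qed auto
  also have "\<dots> = 2 * real N * norm (x - y)" unfolding uv(3) by (simp add: M algebra_simps)
  finally have top: "norm ((1 - u ^ N) * (1 - v) - (1 - v ^ N) * (1 - u)) \<le> 2 * real N * norm (x - y)" .
  have frac: "a / (n * p) - b / (n * q) = (a * q - b * p) / (n * (p * q))"
    if "n \<noteq> 0" "p \<noteq> 0" "q \<noteq> 0" for a b n p q :: complex
    using that by (simp add: field_simps)
  have "x \<noteq> w" "y \<noteq> w" using d by auto
  then have "poly (mean_poly N w) x = (1 - u ^ N) / (of_nat N * (1 - u))"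
    "poly (mean_poly N w) y = (1 - v ^ N) / (of_nat N * (1 - v))"
    unfolding u_def v_def by (auto intro: poly_mean_poly_eq[OF w])
  then have "poly (mean_poly N w) x - poly (mean_poly N w) y
      = ((1 - u ^ N) * (1 - v) - (1 - v ^ N) * (1 - u)) / (of_nat N * ((1 - u) * (1 - v)))"
    using frac[of "of_nat N" "1 - u" "1 - v"] N ne by simp
  also have "norm \<dots> \<le> (2 * real N * norm (x - y)) / (N * (d * d))"
    unfolding norm_divide norm_mult[of "of_nat N"] norm_mult[of "1 - u"] du norm_of_nat
    using N d by (intro frac_le top mult_left_mono mult_mono) auto
  also have "\<dots> = 2 / d\<^sup>2 * norm (x - y)"
    using N by (simp add: power2_eq_square)
  finally show ?thesis .
qed

text \<open>Away from \<open>w\<close> the values of the mean are small, but its Lipschitz bound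
  merely stays bounded. Squaring multiplies the latter by the former, so increments become small as
  well.\<close>

definition bump :: "nat \<Rightarrow> complex \<Rightarrow> complex poly"
  where "bump N w = (mean_poly N w)\<^sup>2"

lemma bump_self: "norm w = 1 \<Longrightarrow> N \<ge> 1 \<Longrightarrow> poly (bump N w) w = 1"
  by (simp add: bump_def mean_poly_self)

text \<open>At most \<open>N\<close> terms of the convolution survive, each at most
  \<open>1 / N\<close> times \<open>1 / N\<close>.\<close>

lemma coeff_bump_bound:
  assumes w: "norm w = 1" and N: "N \<ge> 1"
  shows "norm (coeff (bump N w) k) \<le> (if k < 2 * N then 1 / N else 0)"
proof -
  let ?a = "coeff (mean_poly N w)"
  have a: "norm (?a i) \<le> (if i < N then 1 / N else 0)" for i
    using w by (simp add: coeff_mean_poly norm_divide norm_power)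
  have c: "coeff (bump N w) k = (\<Sum>i\<le>k. ?a i * ?a (k - i))"
    by (simp add: bump_def power2_eq_square coeff_mult)
  show ?thesis
  proof (cases "k < 2 * N")
    case True
    have "norm (\<Sum>i\<le>k. ?a i * ?a (k - i)) \<le> (\<Sum>i\<le>k. if i < N then (1 / N) * (1 / N) else 0)"
    proof (rule sum_norm_le)
      fix i
      show "norm (?a i * ?a (k - i)) \<le> (if i < N then (1 / N) * (1 / N) else 0)"
        using a[of i] a[of "k - i"] mult_mono[of "norm (?a i)" "1 / N" "norm (?a (k - i))" "1 / N"]
        unfolding norm_mult by (auto split: if_splits)
    qed
    also have "\<dots> = (\<Sum>i\<in>{..k} \<inter> {..<N}. (1 / N) * (1 / N))"
      by (simp add: sum.If_cases lessThan_def)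
    also have "\<dots> \<le> (\<Sum>i<N. (1 / N) * (1 / N))"
      by (intro sum_mono2) auto
    finally show ?thesis using True N c by simp
  next
    case False
    then have "?a i * ?a (k - i) = 0" if "i \<le> k" for i
      using that by (auto simp: coeff_mean_poly)
    then have "(\<Sum>i\<le>k. ?a i * ?a (k - i)) = 0" by (intro sum.neutral) auto
    then show ?thesis using False c by simp
  qed
qed

lemma bump_hardy:
  assumes w: "norm w = 1" and N: "N \<ge> 1"
  shows "(\<Sum>k<n. (norm (taylor k (disc_poly (bump N w))))\<^sup>2) \<le> 2 / N"
proof -
  have "(\<Sum>k<n. (norm (taylor k (disc_poly (bump N w))))\<^sup>2) \<le> (\<Sum>k<n. if k < 2 * N then (1 / N)\<^sup>2 else 0)"
  proof (rule sum_mono)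
    fix k
    show "(norm (taylor k (disc_poly (bump N w))))\<^sup>2 \<le> (if k < 2 * N then (1 / N)\<^sup>2 else 0)"
      using coeff_bump_bound[OF assms, of k] power_mono[of "norm (coeff (bump N w) k)" "1 / N" 2]
      by (auto simp: taylor_disc_poly split: if_splits)
  qed
  also have "\<dots> = (\<Sum>k\<in>{..<n} \<inter> {..<2 * N}. (1 / N)\<^sup>2)"
    by (simp add: sum.If_cases lessThan_def)
  also have "\<dots> \<le> (\<Sum>k<2 * N. (1 / N)\<^sup>2)"
    by (intro sum_mono2) auto
  also have "\<dots> = 2 / N" using N by (simp add: power2_eq_square)
  finally show ?thesis .
qed

lemma norm_power2_diff_le:
  fixes a b :: complex
  assumes "norm a \<le> M" "norm b \<le> M"
  shows "norm (a\<^sup>2 - b\<^sup>2) \<le> 2 * M * norm (a - b)"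
proof -
  have "norm (a\<^sup>2 - b\<^sup>2) = norm (a + b) * norm (a - b)"
    by (simp add: power2_eq_square square_diff_square_factored norm_mult)
  also have "\<dots> \<le> (2 * M) * norm (a - b)"
    using assms norm_triangle_ineq[of a b] by (intro mult_right_mono) auto
  finally show ?thesis .
qed

text \<open>Meant for nodes that may approach \<open>w\<close>: the growth in \<open>N\<close> is
  later offset by small weights.\<close>

lemma bump_global:
  assumes w: "norm w = 1" and N: "N \<ge> 1" and x: "norm x \<le> 1" and y: "norm y \<le> 1"
  shows "norm (poly (bump N w) x - poly (bump N w) y) \<le> 2 * real N * norm (x - y)"
    and "norm (poly (bump N w) y) \<le> 1"
proof -
  note b = mean_poly_bound[OF w N x] mean_poly_bound[OF w N y]
  show "norm (poly (bump N w) y) \<le> 1"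
    using b by (simp add: bump_def norm_power power_le_one)
  have "norm (poly (bump N w) x - poly (bump N w) y)
      \<le> 2 * 1 * norm (poly (mean_poly N w) x - poly (mean_poly N w) y)"
    unfolding bump_def poly_power by (rule norm_power2_diff_le[OF b])
  also have "\<dots> \<le> 2 * 1 * (N * norm (x - y))"
    by (intro mult_left_mono mean_poly_lipschitz assms) auto
  finally show "norm (poly (bump N w) x - poly (bump N w) y) \<le> 2 * real N * norm (x - y)" by simp
qed

lemma bump_away:
  assumes w: "norm w = 1" and N: "N \<ge> 1" and x: "norm x \<le> 1" and y: "norm y \<le> 1"
    and d: "0 < d" "d \<le> norm (x - w)" "d \<le> norm (y - w)"
  shows "norm (poly (bump N w) x - poly (bump N w) y) \<le> 8 / (N * d ^ 3) * norm (x - y)"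
    and "norm (poly (bump N w) y) \<le> 4 / (N * d)\<^sup>2"
proof -
  note b = mean_poly_away_bound[OF w N x d(1,2)] mean_poly_away_bound[OF w N y d(1,3)]
  have "(norm (poly (mean_poly N w) y))\<^sup>2 \<le> (2 / (N * d))\<^sup>2"
    by (intro power_mono b) auto
  then show "norm (poly (bump N w) y) \<le> 4 / (N * d)\<^sup>2"
    by (simp add: bump_def norm_power power_divide)
  have "norm (poly (bump N w) x - poly (bump N w) y)
      \<le> 2 * (2 / (N * d)) * norm (poly (mean_poly N w) x - poly (mean_poly N w) y)"
    unfolding bump_def poly_power by (rule norm_power2_diff_le[OF b])
  also have "\<dots> \<le> 2 * (2 / (N * d)) * (2 / d\<^sup>2 * norm (x - y))"
    using d by (intro mult_left_mono mean_poly_away_lipschitz assms) auto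
  also have "\<dots> = 8 / (N * d ^ 3) * norm (x - y)"
    by (simp add: power2_eq_square power3_eq_cube)
  finally show "norm (poly (bump N w) x - poly (bump N w) y) \<le> 8 / (N * d ^ 3) * norm (x - y)" .
qed

section \<open>Pairs on the rays through the nets\<close>

text \<open>
  The radii are \<open>(\<tau> m)\<^sup>2\<close>, the form in which the Lipschitz estimate of the Hardy space is stated.
\<close>

definition \<tau> :: "nat \<Rightarrow> real"
  where "\<tau> m = 1 - (1 / 256) ^ m"

lemma \<tau>_bounds: "0 \<le> \<tau> m" "\<tau> m < 1"
  by (auto simp: \<tau>_def power_le_one)

lemma \<tau>_mono: "\<tau> m \<le> \<tau> (Suc m)"
  by (simp add: \<tau>_def)

lemma \<tau>_sq_less_1: "(\<tau> m)\<^sup>2 < 1"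
  using \<tau>_bounds[of m] by (simp add: power_less_one_iff)

lemma \<tau>_sq_diff: "\<bar>(\<tau> (Suc m))\<^sup>2 - (\<tau> m)\<^sup>2\<bar> \<le> 2 * (1 / 256) ^ m"
proof -
  have "(\<tau> (Suc m))\<^sup>2 - (\<tau> m)\<^sup>2 = (\<tau> (Suc m) + \<tau> m) * (\<tau> (Suc m) - \<tau> m)"
    by (simp add: power2_eq_square algebra_simps)
  moreover have "(\<tau> (Suc m) + \<tau> m) * (\<tau> (Suc m) - \<tau> m) \<le> 2 * (1 / 256) ^ m"
    using \<tau>_bounds[of m] \<tau>_bounds[of "Suc m"] \<tau>_mono[of m]
    by (intro mult_mono) (auto simp: \<tau>_def)
  moreover have "0 \<le> (\<tau> (Suc m) + \<tau> m) * (\<tau> (Suc m) - \<tau> m)"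
    using \<tau>_bounds[of m] \<tau>_bounds[of "Suc m"] \<tau>_mono[of m] by simp
  ultimately show ?thesis by simp
qed

lemma \<tau>_sq_tendsto: "(\<lambda>m. (\<tau> m)\<^sup>2) \<longlonglongrightarrow> 1"
proof -
  have "(\<lambda>m. (1 - (1 / 256) ^ m)\<^sup>2) \<longlonglongrightarrow> (1 - 0 :: real)\<^sup>2"
    by (intro tendsto_intros LIMSEQ_power_zero) auto
  then show ?thesis by (simp add: \<tau>_def)
qed

lemma sum_half_power_le: "(\<Sum>m<M. (1 / 2 :: real) ^ m) \<le> 2"
proof -
  have "(\<Sum>m<M. (1 / 2 :: real) ^ m) = 2 * (1 - (1 / 2) ^ M)"
    by (subst sum_gp_strict) simp
  then show ?thesis by simp
qed

text \<open>The constants are matched to the radii. At level \<open>m\<close> the Hardy Lipschitz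
  cost is \<open>4096 ^ Suc m\<close> and the mesh required later is
  \<open>7 / 8192 ^ Suc m\<close>, so their product halves from level to level. Squared lengths
  times the weight \<open>4 ^ m\<close> are of order \<open>1 / 16384 ^ m\<close>, so
  \<open>8192 ^ Suc m\<close> nodes again leave the ratio 1/2.\<close>

locale net_family =
  fixes A :: "nat \<Rightarrow> nat \<Rightarrow> complex set" and \<epsilon> :: "nat \<Rightarrow> real"
  assumes finite_A: "\<And>n m. finite (A n m)"
    and A_circle: "\<And>n m. A n m \<subseteq> \<bbbT>"
    and card_A: "\<And>n m. card (A n m) \<le> 8192 ^ Suc m"
    and \<epsilon>_pos: "\<And>n. 0 < \<epsilon> n"
    and \<epsilon>_le: "\<And>n. \<epsilon> n \<le> (1 / 2) ^ n"
begin

definition "nodes = {(n, m, \<zeta>). \<zeta> \<in> A n m}"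
text \<open>The factor \<open>4 ^ m\<close> forces the increments of a function of finite energy to
  decay like \<open>(1 / 2) ^ m\<close>.\<close>

definition "weight = (\<lambda>(n, m, \<zeta> :: complex). \<epsilon> n * 4 ^ m)"
definition "outer = (\<lambda>(n :: nat, m, \<zeta>). of_real ((\<tau> (Suc m))\<^sup>2) * \<zeta> :: complex)"
definition "inner_pt = (\<lambda>(n :: nat, m, \<zeta>). of_real ((\<tau> m)\<^sup>2) * \<zeta> :: complex)"

lemma outer_inner_diff:
  assumes "(n, m, \<zeta>) \<in> nodes"
  shows "norm (outer (n, m, \<zeta>) - inner_pt (n, m, \<zeta>)) \<le> 2 * (1 / 256) ^ m"
proof -
  have "norm \<zeta> = 1" using assms A_circle by (force simp: nodes_def)
  moreover have "outer (n, m, \<zeta>) - inner_pt (n, m, \<zeta>) = of_real ((\<tau> (Suc m))\<^sup>2 - (\<tau> m)\<^sup>2) * \<zeta>"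
    by (simp add: outer_def inner_pt_def algebra_simps)
  ultimately show ?thesis
    using \<tau>_sq_diff[of m] by (simp only: norm_mult norm_of_real mult_1_right)
qed

text \<open>The factor \<open>h\<close> lets one estimate serve twice: constant for
  \<open>weight_bound\<close>, two-valued for the energy of the peaking polynomials. In 65536 there
  is a 4 from the squared lengths, 8192 from the cardinalities and 2 from the geometric
  series.\<close>

lemma weighted_sum_le:
  assumes T: "finite T" "T \<subseteq> nodes" and h: "\<And>n. 0 \<le> h n"
    and B: "\<And>M. (\<Sum>n<M. \<epsilon> n * h n) \<le> B"
  shows "(\<Sum>j\<in>T. weight j * (norm (outer j - inner_pt j))\<^sup>2 * h (fst j)) \<le> 65536 * B"
proof -
  \<comment> \<open>A bound on all indices in \<open>T\<close>, so that the sum can be enlarged to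
    an iterated sum over \<open>n\<close> and \<open>m\<close>.\<close>
  define M where "M = Suc (Max (insert 0 (fst ` T \<union> (fst \<circ> snd) ` T)))"
  have M: "n < M \<and> m < M" if "(n, m, \<zeta>) \<in> T" for n m \<zeta>
  proof -
    have "n \<in> fst ` T" "m \<in> (fst \<circ> snd) ` T" using that by force+
    then have "n \<le> Max (insert 0 (fst ` T \<union> (fst \<circ> snd) ` T))" "m \<le> Max (insert 0 (fst ` T \<union> (fst \<circ> snd) ` T))"
      using T(1) by (auto intro!: Max_ge)
    then show ?thesis by (simp add: M_def)
  qed
  define W where "W = (SIGMA n:{..<M}. SIGMA m:{..<M}. A n m)"
  have W: "finite W" "T \<subseteq> W"
    using M T(2) finite_A by (auto simp: W_def nodes_def)
  define g where "g n m = \<epsilon> n * h n * (4 * (1 / 16384) ^ m)" for n m :: nat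
  have g0: "0 \<le> g n m" for n m
    using \<epsilon>_pos[of n] h[of n] by (simp add: g_def)
  have "(\<Sum>j\<in>T. weight j * (norm (outer j - inner_pt j))\<^sup>2 * h (fst j)) \<le> (\<Sum>(n, m, \<zeta>)\<in>T. g n m)"
  proof (intro sum_mono)
    fix j assume "j \<in> T"
    obtain n m \<zeta> where j: "j = (n, m, \<zeta>)" by (cases j)
    then have "(n, m, \<zeta>) \<in> nodes" using \<open>j \<in> T\<close> T by auto
    then have "(norm (outer j - inner_pt j))\<^sup>2 \<le> (2 * (1 / 256) ^ m)\<^sup>2"
      using outer_inner_diff j by (intro power_mono) auto
    then have "weight j * (norm (outer j - inner_pt j))\<^sup>2 * h (fst j)
        \<le> (\<epsilon> n * 4 ^ m) * (2 * (1 / 256) ^ m)\<^sup>2 * h n"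
      unfolding j weight_def prod.case fst_conv
      using \<epsilon>_pos[of n] h[of n] by (intro mult_right_mono mult_left_mono) auto
    also have "\<dots> = g n m"
    proof -
      have "(4 :: real) ^ m * ((1 / 256) ^ m)\<^sup>2 = (1 / 16384) ^ m"
        by (simp add: power2_eq_square flip: power_mult_distrib)
      then show ?thesis by (simp add: g_def power_mult_distrib)
    qed
    finally show "weight j * (norm (outer j - inner_pt j))\<^sup>2 * h (fst j) \<le> (case j of (n, m, \<zeta>) \<Rightarrow> g n m)"
      by (simp add: j)
  qed
  also have "\<dots> \<le> (\<Sum>(n, m, \<zeta>)\<in>W. g n m)"
    using W g0 by (intro sum_mono2) auto
  also have "\<dots> = (\<Sum>n<M. \<Sum>m<M. card (A n m) * g n m)"
    unfolding W_def using finite_A by (simp add: sum.Sigma[symmetric])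
  also have "\<dots> \<le> (\<Sum>n<M. \<epsilon> n * h n * 65536)"
  proof (rule sum_mono)
    fix n
    have "(\<Sum>m<M. card (A n m) * g n m) \<le> (\<Sum>m<M. \<epsilon> n * h n * 32768 * (1 / 2) ^ m)"
    proof (rule sum_mono)
      fix m
      have "real (card (A n m)) \<le> 8192 ^ Suc m"
        using card_A[of n m] by (metis of_nat_le_iff of_nat_numeral of_nat_power)
      then have "card (A n m) * g n m \<le> 8192 ^ Suc m * g n m"
        by (rule mult_right_mono[OF _ g0])
      also have "\<dots> = \<epsilon> n * h n * 32768 * (8192 ^ m * (1 / 16384) ^ m)"
        by (simp add: g_def)
      also have "\<dots> = \<epsilon> n * h n * 32768 * (1 / 2) ^ m"
        by (simp flip: power_mult_distrib)
      finally show "card (A n m) * g n m \<le> \<epsilon> n * h n * 32768 * (1 / 2) ^ m" .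
    qed
    also have "\<dots> = \<epsilon> n * h n * 32768 * (\<Sum>m<M. (1 / 2) ^ m)"
      by (simp only: sum_distrib_left)
    also have "\<dots> \<le> \<epsilon> n * h n * 32768 * 2"
      using \<epsilon>_pos[of n] h[of n] by (intro mult_left_mono sum_half_power_le) simp
    finally show "(\<Sum>m<M. card (A n m) * g n m) \<le> \<epsilon> n * h n * 65536" by simp
  qed
  also have "\<dots> = 65536 * (\<Sum>n<M. \<epsilon> n * h n)"
    unfolding sum_distrib_right[symmetric] by simp
  also have "\<dots> \<le> 65536 * B" using B by simp
  finally show ?thesis .
qed

lemma sum_\<epsilon>_le: "(\<Sum>n<M. \<epsilon> n) \<le> 2"
  using sum_mono[of "{..<M}" \<epsilon> "\<lambda>n. (1 / 2) ^ n"] sum_half_power_le[of M] \<epsilon>_le by simp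

lemma scaled_node_disc: "(n, m, \<zeta>) \<in> nodes \<Longrightarrow> of_real ((\<tau> k)\<^sup>2) * \<zeta> \<in> \<bbbD>"
  using A_circle[of n m] \<tau>_sq_less_1[of k] by (force simp: nodes_def norm_mult norm_power)

sublocale pair_family nodes weight outer inner_pt 131072
proof
  fix j assume j: "j \<in> nodes"
  show "0 \<le> weight j" using \<epsilon>_pos by (auto simp: weight_def less_imp_le split: prod.split)
  show "outer j \<in> \<bbbD>" "inner_pt j \<in> \<bbbD>"
    using j scaled_node_disc by (cases j; auto simp: outer_def inner_pt_def)+
next
  fix T assume "finite T" "T \<subseteq> nodes"
  then show "(\<Sum>j\<in>T. weight j * (norm (outer j - inner_pt j))\<^sup>2) \<le> 131072"
    using weighted_sum_le[of T "\<lambda>_. 1" 2] sum_\<epsilon>_le by simp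
qed

text \<open>The path goes from the ray of \<open>w\<close> across to the ray of
  \<open>\<zeta>\<close>, along it, and back. The two crossings at fixed radius obey the Hardy
  Lipschitz estimate, and the radial move is controlled by a single term of the energy.\<close>

lemma radial_step:
  assumes F: "F \<in> pair_space" and w: "norm w = 1"
    and \<zeta>: "\<zeta> \<in> A n m" "norm (w - \<zeta>) \<le> 7 / 8192 ^ Suc m"
  shows "norm (F (of_real ((\<tau> (Suc m))\<^sup>2) * w) - F (of_real ((\<tau> m)\<^sup>2) * w))
    \<le> (7 + 1 / sqrt (\<epsilon> n)) * sqrt (pair_nsq F) * (1 / 2) ^ m"
proof -
  define e where "e = sqrt (pair_nsq F)"
  have e: "e \<ge> 0" "e\<^sup>2 = pair_nsq F" by (auto simp: e_def energy_nonneg)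
  have node: "(n, m, \<zeta>) \<in> nodes" using \<zeta> by (simp add: nodes_def)
  have n\<zeta>: "norm \<zeta> = 1" using \<zeta> A_circle by force
  define X Y where "X = outer (n, m, \<zeta>)" and "Y = inner_pt (n, m, \<zeta>)"
  have side: "norm (F (of_real ((\<tau> k)\<^sup>2) * w) - F (of_real ((\<tau> k)\<^sup>2) * \<zeta>)) \<le> 7 / 2 * e * (1 / 2) ^ m"
    if k: "\<tau> k \<le> \<tau> (Suc m)" for k
  proof -
    let ?t = "\<tau> (Suc m)"
    have tk: "(\<tau> k)\<^sup>2 \<le> ?t\<^sup>2" using k \<tau>_bounds[of k] by (intro power_mono) auto
    have "norm (of_real ((\<tau> k)\<^sup>2) * w - of_real ((\<tau> k)\<^sup>2) * \<zeta>) = (\<tau> k)\<^sup>2 * norm (w - \<zeta>)"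
      by (simp add: norm_mult norm_power flip: right_diff_distrib)
    also have "\<dots> \<le> 1 * (7 / 8192 ^ Suc m)"
      using \<zeta>(2) \<tau>_sq_less_1[of k] by (intro mult_mono) auto
    finally have dist: "norm (of_real ((\<tau> k)\<^sup>2) * w - of_real ((\<tau> k)\<^sup>2) * \<zeta>) \<le> 7 / 8192 ^ Suc m" by simp
    have "(norm (F (of_real ((\<tau> k)\<^sup>2) * w) - F (of_real ((\<tau> k)\<^sup>2) * \<zeta>)))\<^sup>2
        \<le> (norm (of_real ((\<tau> k)\<^sup>2) * w - of_real ((\<tau> k)\<^sup>2) * \<zeta>))\<^sup>2 * (pair_nsq F / (1 - ?t) ^ 3)"
      using tk w n\<zeta> \<tau>_bounds[of "Suc m"]
      by (intro hardy_lipschitz[OF pair_space_Hol[OF F] taylor_le_pair_nsq[OF F]])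
         (auto simp: norm_mult norm_power)
    also have "\<dots> \<le> (7 / 8192 ^ Suc m)\<^sup>2 * (e\<^sup>2 / (1 - ?t) ^ 3)"
      unfolding e(2) using dist \<tau>_bounds[of "Suc m"]
      by (intro mult_right_mono power_mono) (auto simp: energy_nonneg)
    also have "\<dots> = (7 * e * (4096 ^ Suc m / 8192 ^ Suc m))\<^sup>2"
    proof -
      \<comment> \<open>Both \<open>256 ^ 3\<close> and \<open>4096\<^sup>2\<close> equal
        \<open>2 ^ 24\<close>.\<close>
      have "(1 - ?t) ^ 3 = 1 / (4096 ^ Suc m)\<^sup>2"
        by (simp add: \<tau>_def power_divide power2_eq_square power3_eq_cube flip: power_mult_distrib)
      then show ?thesis by (simp add: power_mult_distrib power_divide)
    qed
    also have "(4096 :: real) ^ Suc m / 8192 ^ Suc m = (1 / 2) ^ Suc m"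
      by (simp flip: power_divide)
    finally have "norm (F (of_real ((\<tau> k)\<^sup>2) * w) - F (of_real ((\<tau> k)\<^sup>2) * \<zeta>)) \<le> 7 * e * (1 / 2) ^ Suc m"
      by (rule power2_le_imp_le) (use e in auto)
    then show ?thesis by simp
  qed
  have "q F (n, m, \<zeta>) \<le> pair_nsq F"
    using q_le_pair_nsq[OF F, of "{(n, m, \<zeta>)}"] node by simp
  then have "weight (n, m, \<zeta>) * (norm (F X - F Y))\<^sup>2 \<le> e\<^sup>2"
    unfolding pair_energy_def X_def Y_def e(2) distrib_left
    using c_nonneg[OF node] by (smt (verit) mult_nonneg_nonneg zero_le_power2)
  moreover have four: "((2 :: real) ^ m)\<^sup>2 = 4 ^ m"
    by (simp add: power2_eq_square flip: power_mult_distrib)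
  ultimately have "(2 ^ m * sqrt (\<epsilon> n) * norm (F X - F Y))\<^sup>2 \<le> e\<^sup>2"
    using \<epsilon>_pos[of n] by (simp add: weight_def power_mult_distrib four mult_ac)
  then have "2 ^ m * sqrt (\<epsilon> n) * norm (F X - F Y) \<le> e"
    by (rule power2_le_imp_le[OF _ e(1)])
  then have mid: "norm (F X - F Y) \<le> (1 / sqrt (\<epsilon> n)) * e * (1 / 2) ^ m"
    using \<epsilon>_pos[of n] by (simp add: field_simps power_divide)
  have "norm (F (of_real ((\<tau> (Suc m))\<^sup>2) * w) - F (of_real ((\<tau> m)\<^sup>2) * w))
      \<le> norm (F (of_real ((\<tau> (Suc m))\<^sup>2) * w) - F X) + norm (F X - F Y) + norm (F (of_real ((\<tau> m)\<^sup>2) * w) - F Y)"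
    by norm
  also have "\<dots> \<le> 7 / 2 * e * (1 / 2) ^ m + (1 / sqrt (\<epsilon> n)) * e * (1 / 2) ^ m + 7 / 2 * e * (1 / 2) ^ m"
    using side[of "Suc m"] side[of m] mid \<tau>_mono[of m]
    by (intro add_mono) (simp_all add: X_def Y_def outer_def inner_pt_def)
  also have "\<dots> = (7 + 1 / sqrt (\<epsilon> n)) * e * (1 / 2) ^ m"
    by (simp add: algebra_simps)
  finally show ?thesis unfolding e_def .
qed

text \<open>The extended evaluation is the limit of \<open>F\<close> along the radii
  \<open>(\<tau> m)\<^sup>2\<close>. By \<open>radial_step\<close> the increments are dominated by a
  geometric series, which gives existence and a bound for every \<open>F\<close> of finite
  energy.\<close>

lemma net_point_in_Omega_max:
  assumes w: "norm w = 1" and net: "\<And>m. \<exists>\<zeta>\<in>A n m. norm (w - \<zeta>) \<le> 7 / 8192 ^ Suc m"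
  shows "w \<in> Omega_max H ip"
proof -
  define s where "s F m = F (of_real ((\<tau> m)\<^sup>2) * w)" for F :: "complex \<Rightarrow> complex" and m
  define D where "D = 7 + 1 / sqrt (\<epsilon> n)"
  have D: "D \<ge> 0" using \<epsilon>_pos[of n] by (simp add: D_def)
  have step: "norm (s F (Suc m) - s F m) \<le> D * sqrt (pair_nsq F) * (1 / 2) ^ m" if F: "F \<in> pair_space" for F m
    using net[of m] radial_step[OF F w] unfolding s_def D_def by blast
  have bound: "norm (s F M) \<le> (1 + 2 * D) * sqrt (pair_nsq F)" if F: "F \<in> pair_space" for F M
  proof -
    \<comment> \<open>As \<open>\<tau> 0 = 0\<close>, the telescoping sum starts at the
      origin.\<close>
    have "s F 0 = F 0" by (simp add: s_def \<tau>_def)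
    moreover have "(norm (F 0))\<^sup>2 \<le> pair_nsq F / (1 - 0)"
      by (rule hardy_growth[OF pair_space_Hol[OF F] taylor_le_pair_nsq[OF F]]) auto
    ultimately have s0: "norm (s F 0) \<le> sqrt (pair_nsq F)"
      by (simp add: real_le_rsqrt)
    have "s F M = s F 0 + (\<Sum>m<M. s F (Suc m) - s F m)"
      by (simp add: sum_lessThan_telescope)
    also have "norm \<dots> \<le> norm (s F 0) + (\<Sum>m<M. D * sqrt (pair_nsq F) * (1 / 2) ^ m)"
      by (intro order_trans[OF norm_triangle_ineq] add_left_mono sum_norm_le step F)
    also have "\<dots> \<le> sqrt (pair_nsq F) + D * sqrt (pair_nsq F) * 2"
      unfolding sum_distrib_left[symmetric] using D
      by (intro add_mono s0 mult_left_mono sum_half_power_le) (auto simp: energy_nonneg)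
    finally show ?thesis by (simp add: algebra_simps)
  qed
  have conv: "s F \<longlonglongrightarrow> lim (s F)" if F: "F \<in> pair_space" for F
  proof -
    have "summable (\<lambda>m. s F (Suc m) - s F m)"
      by (rule summable_comparison_test'[of "\<lambda>m. D * sqrt (pair_nsq F) * (1 / 2) ^ m" 0])
         (use step[OF F] in \<open>auto intro!: summable_mult summable_geometric\<close>)
    then have "convergent (\<lambda>M. \<Sum>m<M. s F (Suc m) - s F m)"
      by (simp add: summable_iff_convergent)
    then have "convergent (\<lambda>M. s F 0 + (\<Sum>m<M. s F (Suc m) - s F m))"
      by (intro convergent_add convergent_const)
    then have "convergent (s F)"
      by (simp add: sum_lessThan_telescope)
    then show ?thesis by (simp add: convergent_LIMSEQ_iff)
  qed
  show ?thesis
  proof (rule Omega_maxI[where L = "\<lambda>F. lim (s F)" and C = "(1 + 2 * D)\<^sup>2"])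
    fix F G assume FG: "F \<in> pair_space" "G \<in> pair_space"
    have "s (\<lambda>z. F z + G z) = (\<lambda>m. s F m + s G m)" by (auto simp: s_def)
    then show "lim (s (\<lambda>z. F z + G z)) = lim (s F) + lim (s G)"
      using tendsto_add[OF conv[OF FG(1)] conv[OF FG(2)]] by (auto intro!: limI)
  next
    fix c F assume F: "F \<in> pair_space"
    have "s (\<lambda>z. c * F z) = (\<lambda>m. c * s F m)" by (auto simp: s_def)
    then show "lim (s (\<lambda>z. c * F z)) = c * lim (s F)"
      using tendsto_mult_left[OF conv[OF F]] by (auto intro!: limI)
  next
    fix F assume F: "F \<in> pair_space"
    have "norm (lim (s F)) \<le> (1 + 2 * D) * sqrt (pair_nsq F)"
      using tendsto_norm[OF conv[OF F]] bound[OF F] by (blast intro: LIMSEQ_le_const2)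
    then have "(norm (lim (s F)))\<^sup>2 \<le> ((1 + 2 * D) * sqrt (pair_nsq F))\<^sup>2"
      by (intro power_mono) auto
    then show "(norm (lim (s F)))\<^sup>2 \<le> (1 + 2 * D)\<^sup>2 * pair_nsq F"
      by (simp add: power_mult_distrib energy_nonneg)
  next
    fix p
    have "s (disc_poly p) = (\<lambda>m. poly p (of_real ((\<tau> m)\<^sup>2) * w))"
    proof
      show "s (disc_poly p) m = poly p (of_real ((\<tau> m)\<^sup>2) * w)" for m
        using w \<tau>_sq_less_1[of m] by (simp add: s_def disc_poly_def norm_mult norm_power)
    qed
    moreover have "(\<lambda>m. poly p (of_real ((\<tau> m)\<^sup>2) * w)) \<longlonglongrightarrow> poly p (of_real 1 * w)"
      by (intro tendsto_intros tendsto_of_real \<tau>_sq_tendsto tendsto_poly)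
    ultimately show "lim (s (disc_poly p)) = poly p w"
      by (auto intro!: limI)
  qed
qed

text \<open>Nodes with \<open>n \<le> p\<close> stay away from \<open>w\<close>, where the
  polynomial is small; for larger \<open>n\<close> only the global bound is available, and
  \<open>tail\<close> pays for it. The squared bounds of \<open>bump_away\<close> give 64 + 16 = 80,
  which summation over \<open>n\<close> doubles to 160.\<close>

lemma bump_energy:
  assumes w: "norm w = 1" and N: "N \<ge> 1" and d: "0 < d" "d \<le> 1"
    and sep: "\<And>n m \<zeta>. n \<le> p \<Longrightarrow> \<zeta> \<in> A n m \<Longrightarrow> 2 * d \<le> norm (\<zeta> - w)"
    and tail: "\<And>n. p < n \<Longrightarrow> \<epsilon> n * (4 * (real N)\<^sup>2 + 1) \<le> (1 / 4) ^ n"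
  shows "pair_nsq (disc_poly (bump N w)) \<le> 2 / N + 65536 * (160 / (N * d ^ 6) + 2 * (1 / 2) ^ p)"
proof (rule pair_energyI(2)[OF disc_poly_Hol_disc bump_hardy[OF w N]])
  define \<eta> where "\<eta> = 80 / (N * d ^ 6)"
  define h where "h n = (if n \<le> p then \<eta> else 4 * (real N)\<^sup>2 + 1)" for n
  have \<eta>: "0 \<le> \<eta>" using d by (simp add: \<eta>_def)
  fix T assume T: "finite T" "T \<subseteq> nodes"
  have "(\<Sum>j\<in>T. q (disc_poly (bump N w)) j)
      \<le> (\<Sum>j\<in>T. weight j * (norm (outer j - inner_pt j))\<^sup>2 * h (fst j))"
  proof (rule sum_mono)
    fix j assume "j \<in> T"
    then have jn: "j \<in> nodes" using T by auto
    obtain n m \<zeta> where j: "j = (n, m, \<zeta>)" by (cases j)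
    have \<zeta>: "\<zeta> \<in> A n m" using jn by (simp add: j nodes_def)
    then have n\<zeta>: "norm \<zeta> = 1" using A_circle by force
    have xy: "norm (outer j) < 1" "norm (inner_pt j) < 1"
      using x_disc[OF jn] y_disc[OF jn] by auto
    have val: "disc_poly (bump N w) (outer j) = poly (bump N w) (outer j)"
      "disc_poly (bump N w) (inner_pt j) = poly (bump N w) (inner_pt j)"
      using xy by (simp_all add: disc_poly_def)
    show "q (disc_poly (bump N w)) j \<le> weight j * (norm (outer j - inner_pt j))\<^sup>2 * h (fst j)"
    proof (cases "n \<le> p")
      case False
      have "q (disc_poly (bump N w)) j \<le> weight j * (norm (outer j - inner_pt j))\<^sup>2 * ((2 * real N)\<^sup>2 + 1\<^sup>2)"
        using bump_global[OF w N, of "outer j" "inner_pt j"] xy by (intro q_le jn) (auto simp: val)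
      then show ?thesis using False by (simp add: h_def j power_mult_distrib)
    next
      case True
      \<comment> \<open>As \<open>w\<close> lies on the circle, \<open>1 - r\<close> is at most the
        distance from \<open>w\<close> to the radial point, so moving in from \<open>\<zeta>\<close>
        loses at most half of the separation \<open>2 * d\<close>.\<close>
      have away: "d \<le> norm (of_real r * \<zeta> - w)" if r: "0 \<le> r" "r \<le> 1" for r :: real
      proof -
        have "norm (\<zeta> - of_real r * \<zeta>) = 1 - r"
        proof -
          have "\<zeta> - of_real r * \<zeta> = of_real (1 - r) * \<zeta>" by (simp add: algebra_simps)
          then show ?thesis using r n\<zeta> by (simp only: norm_mult norm_of_real) simp
        qed
        moreover have "1 - r \<le> norm (of_real r * \<zeta> - w)"
          using norm_triangle_ineq2[of w "of_real r * \<zeta>"] w n\<zeta> r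
          by (simp add: norm_mult norm_minus_commute)
        moreover have "norm (\<zeta> - w) \<le> norm (\<zeta> - of_real r * \<zeta>) + norm (of_real r * \<zeta> - w)"
          by norm
        ultimately show ?thesis using sep[OF True \<zeta>] by linarith
      qed
      have dxy: "d \<le> norm (outer j - w)" "d \<le> norm (inner_pt j - w)"
        using away[of "(\<tau> (Suc m))\<^sup>2"] away[of "(\<tau> m)\<^sup>2"] \<tau>_sq_less_1[of m] \<tau>_sq_less_1[of "Suc m"]
        by (simp_all add: outer_def inner_pt_def j)
      have "q (disc_poly (bump N w)) j
          \<le> weight j * (norm (outer j - inner_pt j))\<^sup>2 * ((8 / (N * d ^ 3))\<^sup>2 + (4 / (N * d)\<^sup>2)\<^sup>2)"
        using bump_away[OF w N, of "outer j" "inner_pt j" d] xy d dxy by (intro q_le jn) (auto simp: val)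
      also have "\<dots> \<le> weight j * (norm (outer j - inner_pt j))\<^sup>2 * \<eta>"
      proof (intro mult_left_mono)
        have "(8 / (N * d ^ 3))\<^sup>2 = 64 / ((real N)\<^sup>2 * d ^ 6)"
          by (simp add: power_divide power_mult_distrib power_mult[symmetric])
        also have "\<dots> \<le> 64 / (N * d ^ 6)"
          using N d by (intro divide_left_mono mult_right_mono) (auto simp: power2_eq_square)
        finally have 1: "(8 / (N * d ^ 3))\<^sup>2 \<le> 64 / (N * d ^ 6)" .
        have "(4 / (N * d)\<^sup>2)\<^sup>2 = 16 / ((real N) ^ 4 * d ^ 4)"
          by (simp add: power_divide power_mult_distrib power_mult[symmetric])
        also have "\<dots> \<le> 16 / (N * d ^ 6)"
        proof (intro divide_left_mono mult_mono)
          show "real N \<le> real N ^ 4" using N by (intro self_le_power) auto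
          show "d ^ 6 \<le> d ^ 4" using d by (intro power_decreasing) auto
        qed (use N d in auto)
        finally have 2: "(4 / (N * d)\<^sup>2)\<^sup>2 \<le> 16 / (N * d ^ 6)" .
        have "64 / (N * d ^ 6) + 16 / (N * d ^ 6) = \<eta>"
          by (simp add: \<eta>_def flip: add_divide_distrib)
        with 1 2 show "(8 / (N * d ^ 3))\<^sup>2 + (4 / (N * d)\<^sup>2)\<^sup>2 \<le> \<eta>"
          by linarith
      qed (use c_nonneg[OF jn] in auto)
      finally show ?thesis using True by (simp add: h_def j)
    qed
  qed
  also have "\<dots> \<le> 65536 * (2 * \<eta> + 2 * (1 / 2) ^ p)"
  proof (rule weighted_sum_le[OF T])
    show "0 \<le> h n" for n using \<eta> by (simp add: h_def)
    fix M
    \<comment> \<open>One summable majorant covers both cases; for \<open>n > p\<close> the factor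
      \<open>(1 / 4) ^ n\<close> is split so that one half of it supplies smallness in
      \<open>p\<close>.\<close>
    have "\<epsilon> n * h n \<le> (1 / 2) ^ n * \<eta> + (1 / 2) ^ n * (1 / 2) ^ p" for n
    proof (cases "n \<le> p")
      case True
      have "\<epsilon> n * h n \<le> (1 / 2) ^ n * \<eta>"
        using True \<epsilon>_le[of n] \<eta> by (simp add: h_def mult_right_mono)
      then show ?thesis by (smt (verit) mult_nonneg_nonneg zero_le_power half_gt_zero_iff)
    next
      case False
      then have "\<epsilon> n * h n \<le> (1 / 4) ^ n" using tail by (simp add: h_def)
      also have "\<dots> = (1 / 2) ^ n * (1 / 2) ^ n"
        by (simp flip: power_mult_distrib)
      also have "\<dots> \<le> (1 / 2) ^ n * (1 / 2) ^ p"
        using False by (intro mult_left_mono power_decreasing) auto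
      finally show ?thesis using \<eta> by (smt (verit) mult_nonneg_nonneg zero_le_power half_gt_zero_iff)
    qed
    then have "(\<Sum>n<M. \<epsilon> n * h n) \<le> (\<Sum>n<M. (1 / 2) ^ n * (\<eta> + (1 / 2) ^ p))"
      by (intro sum_mono) (simp add: distrib_left)
    also have "\<dots> = (\<Sum>n<M. (1 / 2) ^ n) * (\<eta> + (1 / 2) ^ p)"
      by (simp only: sum_distrib_right)
    also have "\<dots> \<le> 2 * (\<eta> + (1 / 2) ^ p)"
      using \<eta> by (intro mult_right_mono sum_half_power_le) auto
    finally show "(\<Sum>n<M. \<epsilon> n * h n) \<le> 2 * \<eta> + 2 * (1 / 2) ^ p" by (simp add: algebra_simps)
  qed
  finally show "(\<Sum>j\<in>T. q (disc_poly (bump N w)) j) \<le> 65536 * (160 / (N * d ^ 6) + 2 * (1 / 2) ^ p)"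
    by (simp add: \<eta>_def)
qed

end

section \<open>Choice of separations, degrees, nets and weights\<close>

theorem theorem4p5:
  fixes \<Gamma> :: "complex set"
  assumes "\<Gamma> \<subseteq> \<bbbT>" and "fsigma \<Gamma>" and "gdelta \<Gamma>"
  shows "\<exists>H ip. hol_hilbert_space H ip \<and>
           polynomials_dense H ip \<and> evaluations_continuous H ip \<and> shift_continuous H ip \<and>
           Omega_max H ip = \<bbbD> \<union> \<Gamma>"
proof -
  obtain K :: "nat \<Rightarrow> complex set" where K: "\<And>n. closed (K n)" "\<Gamma> = (\<Union>n. K n)"
    using assms(2) by (auto elim: fsigma.cases)
  obtain U :: "nat \<Rightarrow> complex set" where U: "\<And>n. open (U n)" "\<Gamma> = (\<Inter>n. U n)"
    using assms(3) by (auto elim: gdelta.cases)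
  have K_circle: "K n \<subseteq> \<bbbT>" for n using K assms(1) by auto
  \<comment> \<open>The \<open>L p\<close> increase to the complement of \<open>\<Gamma>\<close> in
    the circle, so each is disjoint from every \<open>K n\<close>.\<close>
  define L where "L p = (\<Union>k\<le>p. \<bbbT> - U k)" for p
  \<comment> \<open>Separations and degrees are fixed before the weights. The bound on
    \<open>N\<close> makes the term \<open>160 / (N * d ^ 6)\<close> of \<open>bump_energy\<close>
    at most \<open>2 / (real p + 1)\<close>.\<close>
  have "\<exists>d N. 0 < d \<and> d \<le> 1 \<and> (\<forall>n\<le>p. \<forall>\<zeta>\<in>K n. \<forall>w\<in>L p. 2 * d \<le> norm (\<zeta> - w))
      \<and> 80 * (real p + 1) / d ^ 6 \<le> real N" for p
  proof -
    have "compact (\<Union>n\<le>p. K n)"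
    proof (intro compact_UN ballI)
      show "compact (K n)" for n
        using K(1)[of n] K_circle[of n] by (metis compact_Int_closed compact_sphere inf.absorb_iff2)
    qed auto
    moreover have "closed (L p)"
      unfolding L_def using U(1) by (intro closed_UN ballI closed_Diff) auto
    moreover have "(\<Union>n\<le>p. K n) \<inter> L p = {}"
      using K U by (auto simp: L_def)
    ultimately obtain \<delta> where \<delta>: "\<delta> > 0" "\<And>x y. x \<in> (\<Union>n\<le>p. K n) \<Longrightarrow> y \<in> L p \<Longrightarrow> \<delta> \<le> dist x y"
      using separate_compact_closed by meson
    define d where "d = min 1 (\<delta> / 2)"
    obtain N :: nat where "80 * (real p + 1) / d ^ 6 \<le> real N"
      using real_arch_simple by blast
    moreover have "2 * d \<le> norm (\<zeta> - w)" if "n \<le> p" "\<zeta> \<in> K n" "w \<in> L p" for n \<zeta> w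
    proof -
      have "\<delta> \<le> dist \<zeta> w" using that by (intro \<delta>(2)) auto
      then show ?thesis by (simp add: d_def dist_norm)
    qed
    moreover have "0 < d" "d \<le> 1" using \<delta>(1) by (auto simp: d_def)
    ultimately show ?thesis by blast
  qed
  then obtain d N where d: "\<And>p. 0 < d p" "\<And>p. d p \<le> (1 :: real)"
    and sep: "\<And>p n \<zeta> w. n \<le> p \<Longrightarrow> \<zeta> \<in> K n \<Longrightarrow> w \<in> L p \<Longrightarrow> 2 * d p \<le> norm (\<zeta> - w)"
    and N: "\<And>p. 80 * (real p + 1) / d p ^ 6 \<le> real (N p :: nat)"
    by metis
  have "\<exists>A. finite A \<and> A \<subseteq> K n \<and> card A \<le> 8192 ^ Suc m
      \<and> (\<forall>w\<in>K n. \<exists>\<zeta>\<in>A. norm (w - \<zeta>) \<le> 7 / 8192 ^ Suc m)" for n m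
    using circle_net[OF K_circle[of n], of "8192 ^ Suc m"] by simp
  then obtain A where A: "\<And>n m. finite (A n m)" "\<And>n m. A n m \<subseteq> K n" "\<And>n m. card (A n m) \<le> 8192 ^ Suc m"
    "\<And>n m w. w \<in> K n \<Longrightarrow> \<exists>\<zeta>\<in>A n m. norm (w - \<zeta>) \<le> 7 / 8192 ^ Suc m"
    by metis
  define S where "S n = 1 + (\<Sum>k\<le>n. 4 * (real (N k))\<^sup>2 + 1)" for n
  have S: "S n \<ge> 1" for n by (simp add: S_def sum_nonneg)
  \<comment> \<open>\<open>S n\<close> dominates \<open>4 * (real (N k))\<^sup>2 + 1\<close> for all
    \<open>k \<le> n\<close>, so dividing by it meets the condition \<open>tail\<close> of
    \<open>bump_energy\<close> for every \<open>p < n\<close> at once.\<close>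
  define \<epsilon> where "\<epsilon> n = (1 / 4) ^ n / S n" for n
  have N1: "real p + 1 \<le> real (N p)" "160 / (N p * d p ^ 6) \<le> 2 / (real p + 1)" for p
  proof -
    have d6: "0 < d p ^ 6" "d p ^ 6 \<le> 1" 
      using d(1)[of p] d(2)[of p] by (auto intro: power_le_one)
    have "80 * (real p + 1) \<le> 80 * (real p + 1) / d p ^ 6"
      using d6 by (simp add: le_divide_eq)
    then have "80 * (real p + 1) \<le> real (N p)" by (rule order_trans[OF _ N])
    then show "real p + 1 \<le> real (N p)" by (simp add: distrib_left)
    have "80 * (real p + 1) \<le> N p * d p ^ 6" using N[of p] d6 by (simp add: divide_le_eq)
    then have "160 / (N p * d p ^ 6) \<le> 160 / (80 * (real p + 1))"
      by (intro divide_left_mono) auto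
    also have "\<dots> = 2 / (real p + 1)"
      by (simp del: distrib_left_numeral)
    finally show "160 / (N p * d p ^ 6) \<le> 2 / (real p + 1)" .
  qed
  \<comment> \<open>131074 is 2 from the Hardy term plus 2 times 65536 from the nodes with
    \<open>n \<le> p\<close>; the other 131072 belongs to the nodes with
    \<open>n > p\<close>.\<close>
  have lim: "(\<lambda>p. 131074 / (real p + 1) + 131072 * (1 / 2 :: real) ^ p) \<longlonglongrightarrow> 0"
    by real_asymp
  interpret net_family A \<epsilon>
  proof
    fix n m
    show "finite (A n m)" "card (A n m) \<le> 8192 ^ Suc m" by (fact A)+
    show "A n m \<subseteq> \<bbbT>" using A(2)[of n m] K_circle[of n] by auto
    show "0 < \<epsilon> n" using S[of n] by (simp add: \<epsilon>_def)
    have "\<epsilon> n \<le> (1 / 4) ^ n / 1"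
      unfolding \<epsilon>_def using S[of n] by (intro divide_left_mono) auto
    also have "\<dots> \<le> (1 / 2) ^ n" by (simp add: power_mono)
    finally show "\<epsilon> n \<le> (1 / 2) ^ n" .
  qed
  have energy: "pair_nsq (disc_poly (bump (N p) w)) \<le> 131074 / (real p + 1) + 131072 * (1 / 2) ^ p"
    if w: "norm w = 1" "w \<in> L p" for p w
  proof -
    have "pair_nsq (disc_poly (bump (N p) w))
        \<le> 2 / N p + 65536 * (160 / (N p * d p ^ 6) + 2 * (1 / 2) ^ p)"
    proof (rule bump_energy[OF w(1) _ d])
      show "N p \<ge> 1" using N1(1)[of p] by simp
      show "2 * d p \<le> norm (\<zeta> - w)" if "n \<le> p" "\<zeta> \<in> A n m" for n m \<zeta>
        using sep[OF that(1) _ w(2)] that(2) A(2) by blast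
      fix n assume "p < n"
      then have "4 * (real (N p))\<^sup>2 + 1 \<le> S n"
        using member_le_sum[of p "{..n}" "\<lambda>k. 4 * (real (N k))\<^sup>2 + 1"] by (simp add: S_def)
      then have "\<epsilon> n * (4 * (real (N p))\<^sup>2 + 1) \<le> \<epsilon> n * S n"
        using \<epsilon>_pos[of n] by (intro mult_left_mono) auto
      also have "\<dots> = (1 / 4) ^ n" using S[of n] by (simp add: \<epsilon>_def)
      finally show "\<epsilon> n * (4 * (real (N p))\<^sup>2 + 1) \<le> (1 / 4) ^ n" .
    qed
    also have "2 / N p \<le> 2 / (real p + 1)"
      using N1(1)[of p] by (intro divide_left_mono) auto
    finally have "pair_nsq (disc_poly (bump (N p) w))
        \<le> 2 / (real p + 1) + 65536 * (160 / (N p * d p ^ 6) + 2 * (1 / 2) ^ p)" by simp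
    also have "\<dots> \<le> 2 / (real p + 1) + 65536 * (2 / (real p + 1) + 2 * (1 / 2) ^ p)"
      using N1(2)[of p] by simp
    also have "\<dots> = 131074 / (real p + 1) + 131072 * (1 / 2) ^ p"
    proof -
      have "131074 / (real p + 1) = 2 / (real p + 1) + 131072 / (real p + 1)"
        by (simp flip: add_divide_distrib)
      then show ?thesis by simp
    qed
    finally show ?thesis .
  qed
  have "w \<in> \<bbbD> \<union> \<Gamma>" if "w \<in> Omega_max H ip" for w
  proof (rule ccontr)
    assume notin: "w \<notin> \<bbbD> \<union> \<Gamma>"
    have "norm w \<le> 1" using that Omega_max_subset_cball by auto
    then have w: "norm w = 1" using notin by simp
    obtain k where k: "w \<notin> U k" using notin U(2) by auto
    \<comment> \<open>The \<open>L p\<close> increase, so one index \<open>k\<close> serves all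
      later \<open>p\<close>.\<close>
    have wL: "w \<in> L p" if "p \<ge> k" for p using that k w by (auto simp: L_def)
    obtain C where C: "\<And>p. (norm (poly p w))\<^sup>2 \<le> C * pair_nsq (disc_poly p)"
      using Omega_maxD[OF \<open>w \<in> Omega_max H ip\<close>] by blast
    \<comment> \<open>The peak value 1 at \<open>w\<close> is set against energies tending to 0;
      \<open>max C 0\<close> appears because \<open>C\<close> carries no sign.\<close>
    have le: "1 \<le> max C 0 * (131074 / (real p + 1) + 131072 * (1 / 2) ^ p)" if p: "p \<ge> k" for p
    proof -
      have "N p \<ge> 1" using N1(1)[of p] by simp
      then have "1 \<le> C * pair_nsq (disc_poly (bump (N p) w))"
        using C[of "bump (N p) w"] bump_self[OF w] by simp
      also have "\<dots> \<le> max C 0 * (131074 / (real p + 1) + 131072 * (1 / 2) ^ p)"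
        by (intro mult_mono energy w wL p) (auto simp: energy_nonneg)
      finally show ?thesis .
    qed
    from lim have "(\<lambda>p. max C 0 * (131074 / (real p + 1) + 131072 * (1 / 2) ^ p)) \<longlonglongrightarrow> max C 0 * 0"
      by (rule tendsto_mult_left)
    then have "1 \<le> max C 0 * 0"
      using le by (intro LIMSEQ_le_const) blast+
    then show False by simp
  qed
  moreover have "w \<in> Omega_max H ip" if w: "w \<in> \<Gamma>" for w
  proof -
    obtain n where "w \<in> K n" using w K(2) by auto
    then show ?thesis
      using A(4)[of w n] K_circle[of n] by (intro net_point_in_Omega_max[of w n]) auto
  qed
  ultimately have "Omega_max H ip = \<bbbD> \<union> \<Gamma>"
    using disc_subset_Omega_max by blast
  then show ?thesis
    using hilbert dense evaluations shift_cont by blast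
qed

end
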